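(* Let $\mathcal T$ be a locally finite tree with at least $3$ edges at each vertex and let $o$ be a distinguished vertex of $\mathcal T$. Let $\Gamma$ be a group acting by automorphisms of $\mathcal T$ such that the stabilizer $\Gamma_0$ of $o$ in $\Gamma$ is a proper subgroup of $\Gamma$ and acts transitively on each sphere around $o$. (Then $\mathcal T$ is semi-homogeneous, $(\Gamma,\Gamma_0)$ is a Hecke pair, and $\Gamma$ has either one or two orbits on vertices.) Let $q_0+1$ (respectively $q_1+1$) denote the degree of the vertices at even (respectively odd) distance from $o$, and put $q:=q_0$ if $\mathcal T$ is homogeneous. For $n\in\mathbb N=\{0,1,2,\dots\}$ let $\Gamma_n:=\{\gamma\in\Gamma : d(\gamma\cdot o,o)=n\}$. Then: (1) If $\Gamma$ acts transitively on vertices, then the canonical basis of $\mathbb C[\Gamma,\Gamma_0]$ is the set $\{\Gamma_n : n\in\mathbb N\}$; the map $T\mapsto\Gamma_1$ extends to an isomorphism of the algebra $\mathbb C[T]$ of complex polynomials in the variable $T$ onto $\mathbb C[\Gamma,\Gamma_0]$; and the elements of the canonical basis satisfy the recursion relations $$\Gamma_1\Gamma_n=(q+\delta_{n,1})\,\Gamma_{n-1}+\Gamma_{n+1}\qquad\text{for } n\ge 1 .$$ (2) If $\Gamma$ has two orbits of vertices, then the canonical basis of $\mathbb C[\Gamma,\Gamma_0]$ is the set $\{\Gamma_{2n} : n\in\mathbb N\}$; the map $T\mapsto\Gamma_2$ extends to an isomorphism of $\mathbb C[T]$ onto $\mathbb C[\Gamma,\Gamma_0]$; and the recursion relations are $$\Gamma_2\Gamma_{2n}=(q_0+\delta_{n,1})q_1\,\Gamma_{2n-2}+(q_1-1)\,\Gamma_{2n}+\Gamma_{2n+2}\qquad\text{for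 } n\ge 1 .$$
   Context: Hecke algebras. A pair $(G,H)$ of a group and a subgroup is a Hecke pair if every double coset $HgH$ is a finite union of right cosets $Hx$ (equivalently, every double coset is a finite union of left cosets $xH$; equivalently, for all $g\in G$ the subgroup $H\cap gHg^{-1}$ has finite index in both $H$ and $gHg^{-1}$). For a Hecke pair, $\mathbb Z[G,H]$ is the free $\mathbb Z$-module on the set $H\backslash G/H$ of double cosets (the canonical basis) with the associative multiplication $$HgH\cdot Hg'H=\sum_{HxH\in H\backslash G/H}\alpha(g,g';x)\,HxH,\qquad \alpha(g,g';x)=\#\{(i,j): g_ig'_j\in Hx\},$$ where $HgH=\bigsqcup_i Hg_i$ and $Hg'H=\bigsqcup_j Hg'_j$. Its unit is $H$. Put $\mathbb C[G,H]=\mathbb Z[G,H]\otimes_{\mathbb Z}\mathbb C$. Trees. $d$ is the graph distance on the vertex set; the sphere of radius $n$ around $o$ is the set of vertices at distance $n$ from $o$. A tree is semi-homogeneous if all vertices of the same type (class of the bipartition of the vertex set by parity of distance) have the same degree, and homogeneous if all vertices have the same degree. $\delta_{n,1}$ is the Kronecker delta. A double coset of $\Gamma_0$ is identified with its underlying subset of $\Gamma$. *)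

theory Defs
  imports
    "HOL-Library.Poly_Mapping"
    "HOL-Library.Disjoint_Sets"
    "HOL-Computational_Algebra.Polynomial"
    "HOL-Algebra.QuotRing"
    "HOL-Algebra.Module"
    "HOL-Algebra.Group_Action"
    "Graph_Theory.Digraph_Component"
    "Graph_Theory.Pair_Digraph"
begin

section \<open>Hecke algebras\<close>

definition double_coset :: "('g, 'm) monoid_scheme \<Rightarrow> 'g set \<Rightarrow> 'g \<Rightarrow> 'g set" where
  "double_coset G H g = (H #>\<^bsub>G\<^esub> g) <#>\<^bsub>G\<^esub> H"

definition double_cosets :: "('g, 'm) monoid_scheme \<Rightarrow> 'g set \<Rightarrow> 'g set set" where
  "double_cosets G H = double_coset G H ` carrier G"

definition hecke_pair :: "('g, 'm) monoid_scheme \<Rightarrow> 'g set \<Rightarrow> bool" where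
  "hecke_pair G H \<longleftrightarrow> group G \<and> subgroup H G \<and>
     (\<forall>g\<in>carrier G. \<exists>F. finite F \<and> F \<subseteq> carrier G \<and>
        double_coset G H g = (\<Union>x\<in>F. H #>\<^bsub>G\<^esub> x))"

definition coset_reps :: "('g, 'm) monoid_scheme \<Rightarrow> 'g set \<Rightarrow> 'g set \<Rightarrow> 'g set \<Rightarrow> bool" where
  "coset_reps G H D R \<longleftrightarrow> R \<subseteq> carrier G \<and>
     D = (\<Union>r\<in>R. H #>\<^bsub>G\<^esub> r) \<and> disjoint_family_on (\<lambda>r. H #>\<^bsub>G\<^esub> r) R"

text \<open>
  The structure constant \<open>\<alpha>(g, g'; x)\<close>, as a function of the double cosets
  \<open>D = HgH\<close> and \<open>D' = Hg'H\<close>. For a Hecke pair it does not depend on the choice of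
  the representatives, nor on that of \<open>x\<close> within its double coset.
\<close>
definition hecke_coeff ::
    "('g, 'm) monoid_scheme \<Rightarrow> 'g set \<Rightarrow> 'g set \<Rightarrow> 'g set \<Rightarrow> 'g \<Rightarrow> nat" where
  "hecke_coeff G H D D' x =
     (let R = (SOME R. coset_reps G H D R); R' = (SOME R'. coset_reps G H D' R')
      in card {(a, b). a \<in> R \<and> b \<in> R' \<and> a \<otimes>\<^bsub>G\<^esub> b \<in> H #>\<^bsub>G\<^esub> x})"

definition hecke_const ::
    "('g, 'm) monoid_scheme \<Rightarrow> 'g set \<Rightarrow> 'g set \<Rightarrow> 'g set \<Rightarrow> 'g set \<Rightarrow> nat" where
  "hecke_const G H D D' X = hecke_coeff G H D D' (SOME x. x \<in> X)"

text \<open>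
  The product of basis elements is a sum over all double cosets; it is restricted here to
  those with nonzero coefficient because \<^const>\<open>sum\<close> needs a finite index set
  (for a Hecke pair only finitely many remain).
\<close>
definition hecke_mult ::
    "('g, 'm) monoid_scheme \<Rightarrow> 'g set \<Rightarrow>
     ('g set \<Rightarrow>\<^sub>0 'r::comm_ring_1) \<Rightarrow> ('g set \<Rightarrow>\<^sub>0 'r) \<Rightarrow> ('g set \<Rightarrow>\<^sub>0 'r)" where
  "hecke_mult G H f f' =
     (\<Sum>D\<in>Poly_Mapping.keys f. \<Sum>D'\<in>Poly_Mapping.keys f'.
        \<Sum>X\<in>{X \<in> double_cosets G H. hecke_const G H D D' X \<noteq> 0}.
          Poly_Mapping.single X
            (Poly_Mapping.lookup f D * Poly_Mapping.lookup f' D' * of_nat (hecke_const G H D D' X)))"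

text \<open>
  The Hecke algebra with coefficients in \<open>'r\<close>: the free \<open>'r\<close>-module on the double cosets,
  with the product extended bilinearly from the integral structure constants. At \<open>'r = int\<close>
  this is \<open>\<int>[G,H]\<close>. Since that module is free on the double cosets, its scalar extension
  to \<open>\<complex>\<close> is the instance \<open>'r = complex\<close>; \<open>hecke_mult_of_int\<close> below says that the products agree.
\<close>
definition hecke_algebra ::
    "('g, 'm) monoid_scheme \<Rightarrow> 'g set \<Rightarrow> ('r::comm_ring_1, 'g set \<Rightarrow>\<^sub>0 'r) module" where
  "hecke_algebra G H =
     \<lparr>carrier = {f. Poly_Mapping.keys f \<subseteq> double_cosets G H},
      mult = hecke_mult G H,
      one = Poly_Mapping.single H 1,
      zero = 0,
      add = (+),
      smult = (\<lambda>c. Poly_Mapping.map ((*) c))\<rparr>"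

abbreviation complex_hecke_algebra ::
    "('g, 'm) monoid_scheme \<Rightarrow> 'g set \<Rightarrow> (complex, 'g set \<Rightarrow>\<^sub>0 complex) module" where
  "complex_hecke_algebra \<equiv> hecke_algebra"

definition basis_elem :: "'g set \<Rightarrow> ('g set \<Rightarrow>\<^sub>0 'r::comm_ring_1)" where
  "basis_elem D = Poly_Mapping.single D 1"

definition canonical_basis ::
    "('g, 'm) monoid_scheme \<Rightarrow> 'g set \<Rightarrow> ('g set \<Rightarrow>\<^sub>0 'r::comm_ring_1) set" where
  "canonical_basis G H = basis_elem ` double_cosets G H"

lemma hecke_mult_of_int:
  fixes f f' :: "'g set \<Rightarrow>\<^sub>0 int"
  shows "hecke_mult G H (Poly_Mapping.map of_int f) (Poly_Mapping.map of_int f') =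
    (Poly_Mapping.map of_int (hecke_mult G H f f') :: 'g set \<Rightarrow>\<^sub>0 'r::{comm_ring_1,ring_char_0})"
proof -
  let ?m = "Poly_Mapping.map of_int :: ('g set \<Rightarrow>\<^sub>0 int) \<Rightarrow> ('g set \<Rightarrow>\<^sub>0 'r)"
  have lookup_m: "Poly_Mapping.lookup (?m h) X = of_int (Poly_Mapping.lookup h X)" for h X
    by (simp add: map.rep_eq when_def)
  have keys_m: "Poly_Mapping.keys (?m h) = Poly_Mapping.keys h" for h
    by (auto simp: in_keys_iff lookup_m)
  have m_sum: "?m (sum h A) = (\<Sum>a\<in>A. ?m (h a))" for h and A :: "'g set set"
    by (rule poly_mapping_eqI) (simp add: lookup_m lookup_sum)
  have m_single: "?m (Poly_Mapping.single X c) = Poly_Mapping.single X (of_int c)" for X c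
    by (rule poly_mapping_eqI) (simp add: lookup_m lookup_single when_def)
  show ?thesis
    by (simp add: hecke_mult_def keys_m lookup_m m_sum m_single)
qed

definition poly_algebra :: "('r::comm_ring_1, 'r poly) module" where
  "poly_algebra =
     \<lparr>carrier = UNIV, mult = (*), one = 1, zero = 0, add = (+), smult = Polynomial.smult\<rparr>"

definition algebra_iso :: "('r, 'a, 'm) module_scheme \<Rightarrow> ('r, 'b, 'n) module_scheme \<Rightarrow> ('a \<Rightarrow> 'b) set"
  where "algebra_iso A B =
     {h \<in> ring_iso A B. \<forall>c. \<forall>x\<in>carrier A. h (c \<odot>\<^bsub>A\<^esub> x) = c \<odot>\<^bsub>B\<^esub> h x}"


section \<open>Trees\<close>

text \<open>
  An undirected simple graph is a symmetric loop-free relation on a possibly infinite vertex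
  set. An edge is thus a pair of opposite arcs, so that traversing one back and forth is a
  \<open>cycle\<close> of length 2 in the sense of \<^theory>\<open>Graph_Theory.Arc_Walk\<close>; the cycles of the
  undirected graph are those of length at least 3. (\<open>Digraph_Component.tree\<close> is meant for
  digraphs without opposite arcs and cannot be used here.) Connectedness includes that there
  is a vertex.
\<close>
definition undirected_tree :: "'v pair_pre_digraph \<Rightarrow> bool" where
  "undirected_tree T \<longleftrightarrow> pair_bidirected_digraph T \<and>
     strongly_connected (with_proj T) \<and>
     (\<nexists>p. pre_digraph.cycle (with_proj T) p \<and> 3 \<le> length p)"

definition vertex_degree :: "'v pair_pre_digraph \<Rightarrow> 'v \<Rightarrow> nat" where
  "vertex_degree T v = out_degree (with_proj T) v"

definition locally_finite :: "'v pair_pre_digraph \<Rightarrow> bool" where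
  "locally_finite T \<longleftrightarrow> (\<forall>v\<in>pverts T. finite (out_arcs (with_proj T) v))"

definition graph_dist :: "'v pair_pre_digraph \<Rightarrow> 'v \<Rightarrow> 'v \<Rightarrow> nat" where
  "graph_dist T u v = (LEAST n. \<exists>p. pre_digraph.awalk (with_proj T) u p v \<and> length p = n)"

definition graph_sphere :: "'v pair_pre_digraph \<Rightarrow> 'v \<Rightarrow> nat \<Rightarrow> 'v set" where
  "graph_sphere T x n = {v \<in> pverts T. graph_dist T x v = n}"

definition homogeneous :: "'v pair_pre_digraph \<Rightarrow> bool" where
  "homogeneous T \<longleftrightarrow> (\<forall>u\<in>pverts T. \<forall>v\<in>pverts T. vertex_degree T u = vertex_degree T v)"

definition semi_homogeneous :: "'v pair_pre_digraph \<Rightarrow> bool" where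
  "semi_homogeneous T \<longleftrightarrow>
     (\<forall>u\<in>pverts T. \<forall>v\<in>pverts T. even (graph_dist T u v) \<longrightarrow> vertex_degree T u = vertex_degree T v)"

definition acts_by_automorphisms ::
    "('g, 'm) monoid_scheme \<Rightarrow> 'v pair_pre_digraph \<Rightarrow> ('g \<Rightarrow> 'v \<Rightarrow> 'v) \<Rightarrow> bool" where
  "acts_by_automorphisms G T \<phi> \<longleftrightarrow> group_action G (pverts T) \<phi> \<and>
     (\<forall>g\<in>carrier G. \<forall>u\<in>pverts T. \<forall>v\<in>pverts T.
        (\<phi> g u, \<phi> g v) \<in> parcs T \<longleftrightarrow> (u, v) \<in> parcs T)"

definition displacement_set ::
    "('g, 'm) monoid_scheme \<Rightarrow> 'v pair_pre_digraph \<Rightarrow> ('g \<Rightarrow> 'v \<Rightarrow> 'v) \<Rightarrow> 'v \<Rightarrow> nat \<Rightarrow> 'g set" where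
  "displacement_set G T \<phi> x n = {g \<in> carrier G. graph_dist T (\<phi> g x) x = n}"

end

theory Submission
  imports Defs
begin

text \<open>
  Inverting group elements identifies the right cosets of \<open>\<Gamma>0\<close> with the orbit of \<open>x0\<close>, and the
  double cosets with the spheres contained in this orbit. Under this identification the coefficient
  of \<open>\<Gamma>\<^sub>k\<close> in \<open>\<Gamma>\<^sub>m \<Gamma>\<^sub>n\<close> is the number of vertices \<open>v\<close> with \<open>d(x0, v) = n\<close> and \<open>d(v, y) = m\<close>, for
  any \<open>y\<close> at distance \<open>k\<close> from \<open>x0\<close>. In a tree these numbers can be read off from the parents and
  children of vertices for \<open>m = 1\<close> and \<open>m = 2\<close>, which gives the recursions; associativity is a
  double count of paths with three steps. Since \<open>\<Gamma>\<^sub>1 \<Gamma>\<^sub>n\<close> (or \<open>\<Gamma>\<^sub>2 \<Gamma>\<^sub>2\<^sub>n\<close>) has leading term \<open>\<Gamma>\<^sub>n\<^sub>+\<^sub>1\<close>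
  (or \<open>\<Gamma>\<^sub>2\<^sub>n\<^sub>+\<^sub>2\<close>) with coefficient 1, evaluation of polynomials at the generator is triangular with
  respect to the canonical basis, hence bijective. All vertices at even distance from \<open>x0\<close> lie in the
  orbit of \<open>x0\<close>, because a displaced root has a sibling in its sphere and siblings are at distance 2.
\<close>

section \<open>Distances and spheres in trees\<close>

locale tree_graph = pair_bidirected_digraph T for T :: "'v pair_pre_digraph" +
  assumes connected: "strongly_connected (with_proj T)"
    and acyclic: "cycle p \<Longrightarrow> length p < 3"
    and locally_finite: "locally_finite T"
begin

section \<open>Walks and distances\<close>

abbreviation gdist :: "'v \<Rightarrow> 'v \<Rightarrow> nat" where "gdist \<equiv> graph_dist T"

text \<open>Relational powers replace arc lists, so that facts about distances follow by induction
  on the exponent. The conjunct \<open>u \<in> pverts T\<close> matters for exponent 0, where the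
  power relates every element to itself, vertex or not.\<close>

lemma awalk_length_iff:
  "(\<exists>p. awalk u p v \<and> length p = n) \<longleftrightarrow> u \<in> pverts T \<and> (u, v) \<in> parcs T ^^ n"
proof (induction n arbitrary: u)
  case 0
  then show ?case by (auto simp: awalk_Nil_iff)
next
  case (Suc n)
  have "(\<exists>p. awalk u p v \<and> length p = Suc n) \<longleftrightarrow>
    (\<exists>w. (u, w) \<in> parcs T \<and> (\<exists>p. awalk w p v \<and> length p = n))"
  proof
    assume "\<exists>p. awalk u p v \<and> length p = Suc n"
    then obtain e p where "awalk u (e # p) v" "length p = n"
      by (auto simp: length_Suc_conv)
    then show "\<exists>w. (u, w) \<in> parcs T \<and> (\<exists>p. awalk w p v \<and> length p = n)"
      by (cases e) (auto simp: awalk_Cons_iff)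
  next
    assume "\<exists>w. (u, w) \<in> parcs T \<and> (\<exists>p. awalk w p v \<and> length p = n)"
    then obtain w p where "(u, w) \<in> parcs T" "awalk w p v" "length p = n" by blast
    then show "\<exists>p. awalk u p v \<and> length p = Suc n"
      by (intro exI[of _ "(u, w) # p"]) (auto simp: awalk_Cons_iff)
  qed
  also have "\<dots> \<longleftrightarrow> (\<exists>w. (u, w) \<in> parcs T \<and> (w, v) \<in> parcs T ^^ n)"
    using Suc in_arcsD2 by blast
  also have "\<dots> \<longleftrightarrow> u \<in> pverts T \<and> (u, v) \<in> parcs T ^^ Suc n"
    using relpow_Suc_D2[of u v n "parcs T"] relpow_Suc_I2[of u _ "parcs T" v n] in_arcsD1 by blast
  finally show ?case .
qed

lemma graph_dist_relpow: "graph_dist T u v = (LEAST n. u \<in> pverts T \<and> (u, v) \<in> parcs T ^^ n)"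
  unfolding graph_dist_def awalk_length_iff by simp

lemma relpow_gdist:
  assumes "u \<in> pverts T" "v \<in> pverts T"
  shows "(u, v) \<in> parcs T ^^ gdist u v"
proof -
  have "u \<rightarrow>\<^sup>*\<^bsub>with_proj T\<^esub> v"
    using connected assms by (auto simp: strongly_connected_def)
  then obtain p where "awalk u p v"
    by (auto simp: reachable_awalk)
  then have "\<exists>n. u \<in> pverts T \<and> (u, v) \<in> parcs T ^^ n"
    using awalk_length_iff by blast
  then show ?thesis
    unfolding graph_dist_relpow by (metis (mono_tags, lifting) LeastI_ex)
qed

lemma gdist_le: "u \<in> pverts T \<Longrightarrow> (u, v) \<in> parcs T ^^ n \<Longrightarrow> gdist u v \<le> n"
  unfolding graph_dist_relpow by (simp add: Least_le)

lemma relpow_sym: "(u, v) \<in> parcs T ^^ n \<Longrightarrow> (v, u) \<in> parcs T ^^ n"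
proof (induction n arbitrary: v)
  case (Suc n)
  then obtain w where "(u, w) \<in> parcs T ^^ n" "(w, v) \<in> parcs T" by auto
  then show ?case using Suc.IH arcs_symmetric relpow_Suc_I2 by metis
qed auto

lemma gdist_sym:
  assumes "u \<in> pverts T" "v \<in> pverts T"
  shows "gdist u v = gdist v u"
  by (meson assms gdist_le relpow_gdist relpow_sym order.antisym)

lemma gdist_self [simp]: "u \<in> pverts T \<Longrightarrow> gdist u u = 0"
  using gdist_le[of u u 0] by simp

lemma gdist_eq_0_iff: "u \<in> pverts T \<Longrightarrow> v \<in> pverts T \<Longrightarrow> gdist u v = 0 \<longleftrightarrow> u = v"
  using relpow_gdist[of u v] by auto

lemma gdist_triangle:
  assumes "u \<in> pverts T" "v \<in> pverts T" "w \<in> pverts T"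
  shows "gdist u w \<le> gdist u v + gdist v w"
proof -
  have "(u, w) \<in> parcs T ^^ (gdist u v + gdist v w)"
    using assms relpow_gdist unfolding relpow_add by blast
  then show ?thesis using assms gdist_le by blast
qed

lemma gdist_eq_1_iff:
  assumes "u \<in> pverts T" "v \<in> pverts T"
  shows "gdist u v = 1 \<longleftrightarrow> (u, v) \<in> parcs T"
proof
  assume "gdist u v = 1"
  then show "(u, v) \<in> parcs T" using relpow_gdist[OF assms] by simp
next
  assume a: "(u, v) \<in> parcs T"
  then have "gdist u v \<le> 1" using gdist_le[of u v 1] assms by simp
  moreover have "u \<noteq> v" using no_loops[OF a] by simp
  then have "gdist u v \<noteq> 0" using assms by (simp add: gdist_eq_0_iff)
  ultimately show "gdist u v = 1" by simp
qed

text \<open>The vertex before \<open>v\<close> on a shortest walk from \<open>x\<close> is one step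
  closer to \<open>x\<close>.\<close>

lemma exists_parent:
  assumes "x \<in> pverts T" "v \<in> pverts T" "gdist x v = Suc n"
  obtains u where "(v, u) \<in> parcs T" "gdist x u = n"
proof -
  obtain u where u: "(x, u) \<in> parcs T ^^ n" "(u, v) \<in> parcs T"
    using relpow_gdist[OF assms(1,2)] assms(3) by auto
  have V: "u \<in> pverts T" using u in_arcsD1 by blast
  have "gdist x v \<le> gdist x u + gdist u v" "gdist u v = 1"
    using u(2) assms V gdist_triangle gdist_eq_1_iff by blast+
  moreover have "gdist x u \<le> n" using u assms gdist_le by simp
  ultimately have "gdist x u = n" using assms(3) by linarith
  then show ?thesis using u arcs_symmetric that by blast
qed

section \<open>Consequences of acyclicity\<close>

lemma awalk_verts_snoc: "cas u p w \<Longrightarrow> awalk_verts u (p @ [(w, z)]) = awalk_verts u p @ [z]"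
  by (induction p arbitrary: u) auto

text \<open>Following parents from both vertices until they meet gives a path inside the ball. It
  can be closed by an arc joining its ends or through a vertex outside the ball; as it has at least
  two arcs, the resulting cycle has length at least 3, which \<open>acyclic\<close> forbids.\<close>

lemma apath_in_ball:
  assumes "x \<in> pverts T" "u \<in> pverts T" "u' \<in> pverts T" "u \<noteq> u'" "gdist x u = n" "gdist x u' = n"
  shows "\<exists>p. apath u p u' \<and> 2 \<le> length p \<and> (\<forall>w\<in>set (awalk_verts u p). gdist x w \<le> n)"
  using assms(2-)
proof (induction n arbitrary: u u')
  case 0
  then show ?case using assms(1) gdist_eq_0_iff by auto
next
  case (Suc n)
  obtain w where w: "(u, w) \<in> parcs T" "gdist x w = n"
    using exists_parent[OF assms(1)] Suc.prems by metis
  obtain w' where w': "(u', w') \<in> parcs T" "gdist x w' = n"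
    using exists_parent[OF assms(1)] Suc.prems by metis
  have rev: "(w', u') \<in> parcs T" using w' arcs_symmetric by blast
  have V: "w \<in> pverts T" "w' \<in> pverts T" using w w' in_arcsD2 by auto
  show ?case
  proof (cases "w = w'")
    case True
    have "apath u [(u, w), (w, u')] u'"
      using w w' rev True Suc.prems by (auto simp: apath_simps)
    then show ?thesis using w Suc.prems True by (intro exI[of _ "[(u, w), (w, u')]"]) auto
  next
    case False
    obtain p where p: "apath w p w'" "2 \<le> length p" "\<forall>z\<in>set (awalk_verts w p). gdist x z \<le> n"
      using Suc.IH[OF V False w(2) w'(2)] by auto
    \<comment> \<open>Both ends have distance \<open>Suc n\<close> and \<open>p\<close> stays within
      distance \<open>n\<close>, so prolonging \<open>p\<close> at both ends repeats no
      vertex.\<close>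
    have u': "u' \<notin> set (awalk_verts w p)" and u: "u \<notin> set (awalk_verts w p)"
      using p(3) Suc.prems by auto
    have aw: "awalk w p w'" using p(1) by (simp add: apath_def)
    then have cas: "cas w p w'" by blast
    have aw': "awalk w (p @ [(w', u')]) u'"
      by (rule awalk_appendI[OF aw]) (use rev V Suc.prems in \<open>auto simp: awalk_simps\<close>)
    have "apath u ((u, w) # p @ [(w', u')]) u'"
      using w u u' p(1) aw' Suc.prems by (auto simp: apath_def awalk_Cons_iff awalk_verts_snoc[OF cas])
    moreover have "\<forall>z\<in>set (awalk_verts u ((u, w) # p @ [(w', u')])). gdist x z \<le> Suc n"
      using p(3) Suc.prems by (auto simp: awalk_verts_snoc[OF cas] le_SucI)
    ultimately show ?thesis by (intro exI[of _ "(u, w) # p @ [(w', u')]"]) auto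
  qed
qed

text \<open>An arc within a sphere would close the path of \<open>apath_in_ball\<close> between its
  ends to a cycle of length at least 3.\<close>

lemma adjacent_gdist_neq:
  assumes "x \<in> pverts T" "(u, v) \<in> parcs T"
  shows "gdist x u \<noteq> gdist x v"
proof
  assume eq: "gdist x u = gdist x v"
  have V: "u \<in> pverts T" "v \<in> pverts T" "u \<noteq> v"
    using assms(2) in_arcsD1 in_arcsD2 no_loops[OF assms(2)] by simp_all
  obtain p where p: "apath u p v" "2 \<le> length p"
    using apath_in_ball[OF assms(1) V refl] eq by auto
  have aw: "awalk u p v" using p(1) by (simp add: apath_def)
  then have cas: "cas u p v" by blast
  have "awalk u (p @ [(v, u)]) u"
    by (rule awalk_appendI[OF aw]) (use assms V arcs_symmetric in \<open>auto simp: awalk_simps\<close>)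
  moreover have "distinct (tl (awalk_verts u (p @ [(v, u)])))"
    using p aw unfolding awalk_verts_snoc[OF cas] by (cases p) (auto simp: apath_def awalk_Cons_iff)
  ultimately have "cycle (p @ [(v, u)])" unfolding cycle_def by blast
  then show False using acyclic p(2) by fastforce
qed

text \<open>Two parents would be joined by a path in a ball that does not reach \<open>v\<close>,
  and passing through \<open>v\<close> would close it to a cycle.\<close>

lemma parent_unique:
  assumes "x \<in> pverts T" "(v, u) \<in> parcs T" "(v, u') \<in> parcs T"
    and "gdist x u < gdist x v" "gdist x u = gdist x u'"
  shows "u = u'"
proof (rule ccontr)
  assume "u \<noteq> u'"
  have V: "u \<in> pverts T" "v \<in> pverts T" "u' \<in> pverts T"
    using assms in_arcsD1 in_arcsD2 by auto
  obtain p where p: "apath u p u'" "2 \<le> length p"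
      "\<forall>w\<in>set (awalk_verts u p). gdist x w \<le> gdist x u"
    using apath_in_ball[OF assms(1) V(1,3) \<open>u \<noteq> u'\<close> refl] assms(5) by auto
  have aw: "awalk u p u'" using p(1) by (simp add: apath_def)
  then have cas: "cas u p u'" by blast
  have "awalk u (p @ [(u', v)]) v"
    by (rule awalk_appendI[OF aw]) (use assms V arcs_symmetric in \<open>auto simp: awalk_simps\<close>)
  then have "awalk v ((v, u) # p @ [(u', v)]) v"
    unfolding awalk_Cons_iff using assms by simp
  moreover have "distinct (tl (awalk_verts v ((v, u) # p @ [(u', v)])))"
    using p assms(4) by (auto simp: apath_def awalk_verts_snoc[OF cas])
  ultimately have "cycle ((v, u) # p @ [(u', v)])" unfolding cycle_def by blast
  then show False using acyclic p(2) by fastforce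
qed

lemma adjacent_gdist:
  assumes "x \<in> pverts T" "(u, v) \<in> parcs T"
  shows "gdist x v = Suc (gdist x u) \<or> gdist x u = Suc (gdist x v)"
proof -
  have V: "u \<in> pverts T" "v \<in> pverts T" and r: "(v, u) \<in> parcs T"
    using assms in_arcsD1 in_arcsD2 arcs_symmetric by auto
  then have "gdist u v = 1" "gdist v u = 1"
    using assms by (simp_all only: gdist_eq_1_iff)
  then show ?thesis
    using adjacent_gdist_neq[OF assms] gdist_triangle[of x u v] gdist_triangle[of x v u] assms(1) V
    by linarith
qed

text \<open>The tree is bipartite: every arc changes the parity of the distance to \<open>x\<close>.
  The induction runs along a walk of arbitrary length and is then applied to a shortest one.\<close>

lemma even_gdist_add:
  assumes "x \<in> pverts T" "u \<in> pverts T" "v \<in> pverts T"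
  shows "even (gdist u v) \<longleftrightarrow> even (gdist x u + gdist x v)"
proof -
  have "even n \<longleftrightarrow> even (gdist x u + gdist x v)" if "(u, v) \<in> parcs T ^^ n" for n
    using that
  proof (induction n arbitrary: v)
    case (Suc n)
    then obtain w where w: "(u, w) \<in> parcs T ^^ n" "(w, v) \<in> parcs T" by auto
    show ?case using Suc.IH[OF w(1)] adjacent_gdist[OF assms(1) w(2)] by auto
  qed auto
  then show ?thesis using relpow_gdist assms(2,3) by blast
qed

lemma gdist_eq_2_iff:
  assumes "u \<in> pverts T" "v \<in> pverts T"
  shows "gdist u v = 2 \<longleftrightarrow> u \<noteq> v \<and> (\<exists>w. (u, w) \<in> parcs T \<and> (w, v) \<in> parcs T)"
proof
  assume d: "gdist u v = 2"
  then have "(u, v) \<in> parcs T ^^ 2" using relpow_gdist[OF assms] by simp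
  then show "u \<noteq> v \<and> (\<exists>w. (u, w) \<in> parcs T \<and> (w, v) \<in> parcs T)"
    using d assms by (auto simp: numeral_2_eq_2)
next
  assume "u \<noteq> v \<and> (\<exists>w. (u, w) \<in> parcs T \<and> (w, v) \<in> parcs T)"
  then obtain w where w: "(u, w) \<in> parcs T" "(w, v) \<in> parcs T" "u \<noteq> v" by blast
  have "gdist u w = 1" using w assms in_arcsD2 gdist_eq_1_iff by blast
  then show "gdist u v = 2"
    using adjacent_gdist[OF assms(1) w(2)] w(3) gdist_eq_0_iff[OF assms] by auto
qed

section \<open>Neighbours, parents and children\<close>

definition nbrs :: "'v \<Rightarrow> 'v set" where
  "nbrs v = {w. (v, w) \<in> parcs T}"

text \<open>Set-valued, empty at the root and a singleton at every other vertex, so that it enters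
  unions and cardinalities on the same footing as \<open>children\<close>.\<close>

definition parents :: "'v \<Rightarrow> 'v \<Rightarrow> 'v set" where
  "parents x v = {w. (v, w) \<in> parcs T \<and> Suc (gdist x w) = gdist x v}"

definition children :: "'v \<Rightarrow> 'v \<Rightarrow> 'v set" where
  "children x v = {w. (v, w) \<in> parcs T \<and> gdist x w = Suc (gdist x v)}"

lemma out_arcs_nbrs: "out_arcs (with_proj T) v = Pair v ` nbrs v"
  by (auto simp: out_arcs_def nbrs_def)

lemma finite_nbrs: "finite (nbrs v)"
proof (cases "v \<in> pverts T")
  case True
  then have "finite (Pair v ` nbrs v)"
    using locally_finite by (simp add: locally_finite_def out_arcs_nbrs)
  then show ?thesis by (rule finite_imageD) (simp add: inj_on_def)
next
  case False
  then have "nbrs v = {}" using in_arcsD1 by (auto simp: nbrs_def)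
  then show ?thesis by simp
qed

lemma vertex_degree_nbrs: "vertex_degree T v = card (nbrs v)"
  unfolding vertex_degree_def out_degree_def out_arcs_nbrs
  by (simp add: card_image inj_on_def)

lemma parents_subset: "parents x v \<subseteq> nbrs v" and children_subset: "children x v \<subseteq> nbrs v"
  by (auto simp: parents_def children_def nbrs_def)

lemma finite_parents: "finite (parents x v)" and finite_children: "finite (children x v)"
  using finite_nbrs parents_subset children_subset finite_subset by metis+

lemma nbrs_eq: "x \<in> pverts T \<Longrightarrow> nbrs v = parents x v \<union> children x v"
  using adjacent_gdist[of x v] by (fastforce simp: nbrs_def parents_def children_def)

lemma parents_root: "x \<in> pverts T \<Longrightarrow> parents x x = {}"
  by (auto simp: parents_def)

lemma parents_nonroot:
  assumes "x \<in> pverts T" "v \<in> pverts T" "x \<noteq> v"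
  obtains w where "parents x v = {w}"
proof -
  obtain n where n: "gdist x v = Suc n"
    using assms gdist_eq_0_iff not0_implies_Suc by metis
  obtain w where "(v, w) \<in> parcs T" "gdist x w = n"
    using exists_parent[OF assms(1,2) n] by metis
  then have "parents x v = {w}"
    using parent_unique[OF assms(1), of v] n by (auto simp: parents_def)
  then show ?thesis using that by blast
qed

text \<open>All neighbours are children except the parent, which is missing only at
  \<open>x\<close>. The extra child of the root is the origin of the Kronecker delta in the
  recursions.\<close>

lemma card_children:
  assumes "x \<in> pverts T" "v \<in> pverts T"
  shows "vertex_degree T v = card (children x v) + (if v = x then 0 else 1)"
proof -
  have "card (nbrs v) = card (parents x v) + card (children x v)"
    unfolding nbrs_eq[OF assms(1)]
    by (rule card_Un_disjoint[OF finite_parents finite_children])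
      (auto simp: parents_def children_def)
  moreover have "card (parents x v) = (if v = x then 0 else 1)"
    using parents_root[OF assms(1)] parents_nonroot[OF assms] by (metis card.empty card_1_singleton_iff One_nat_def)
  ultimately show ?thesis by (simp add: vertex_degree_nbrs)
qed

lemma mem_children_iff:
  assumes "x \<in> pverts T"
  shows "w \<in> children x v \<longleftrightarrow> v \<in> parents x w"
  by (auto simp: children_def parents_def arcs_symmetric)

lemma sphere_0: "x \<in> pverts T \<Longrightarrow> graph_sphere T x 0 = {x}"
  by (auto simp: graph_sphere_def gdist_eq_0_iff)

lemma sphere_Suc:
  assumes "x \<in> pverts T"
  shows "graph_sphere T x (Suc n) = (\<Union>v\<in>graph_sphere T x n. children x v)"
proof -
  have "v \<in> (\<Union>v\<in>graph_sphere T x n. children x v)" if "v \<in> graph_sphere T x (Suc n)" for v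
  proof -
    have v: "v \<in> pverts T" "gdist x v = Suc n" using that by (auto simp: graph_sphere_def)
    obtain u where "(v, u) \<in> parcs T" "gdist x u = n" by (rule exists_parent[OF assms v])
    then have "u \<in> graph_sphere T x n" "v \<in> children x u"
      using v arcs_symmetric in_arcsD2 by (auto simp: graph_sphere_def children_def)
    then show ?thesis by blast
  qed
  moreover have "children x v \<subseteq> graph_sphere T x (Suc n)" if "v \<in> graph_sphere T x n" for v
    using that in_arcsD2 by (auto simp: children_def graph_sphere_def)
  ultimately show ?thesis by blast
qed

lemma finite_sphere: "x \<in> pverts T \<Longrightarrow> finite (graph_sphere T x n)"
  by (induction n) (auto simp: sphere_0 sphere_Suc finite_children)

section \<open>Intersections of two spheres\<close>

text \<open>With \<open>x\<close> the root and \<open>y\<close> at distance \<open>k\<close> from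
  it, the cardinality will be the coefficient of \<open>\<Gamma>\<^sub>k\<close> in
  \<open>\<Gamma>\<^sub>m \<Gamma>\<^sub>n\<close>: the radius \<open>n\<close> around
  \<open>x\<close> belongs to the right factor, the radius \<open>m\<close> around \<open>y\<close>
  to the left one.\<close>

definition sphere_inter :: "'v \<Rightarrow> nat \<Rightarrow> 'v \<Rightarrow> nat \<Rightarrow> 'v set" where
  "sphere_inter x n y m = graph_sphere T x n \<inter> graph_sphere T y m"

lemma sphere_inter_nonempty_le:
  assumes "x \<in> pverts T" "y \<in> pverts T" "sphere_inter x n y m \<noteq> {}"
  shows "gdist x y \<le> n + m"
  using assms gdist_triangle[of x _ y] gdist_sym[of y]
  by (fastforce simp: sphere_inter_def graph_sphere_def)

lemma sphere_inter_1:
  assumes x: "x \<in> pverts T" and y: "y \<in> pverts T"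
  shows "sphere_inter x n y 1 =
    (if gdist x y = Suc n then parents x y else if n = Suc (gdist x y) then children x y else {})"
proof -
  have "sphere_inter x n y 1 = {v. (y, v) \<in> parcs T \<and> gdist x v = n}"
    using gdist_eq_1_iff[OF y] in_arcsD2
    by (auto simp: sphere_inter_def graph_sphere_def)
  then show ?thesis
    using adjacent_gdist[OF x, of y] by (auto simp: parents_def children_def)
qed

lemma sphere_inter_2:
  assumes x: "x \<in> pverts T" and y: "y \<in> pverts T"
  shows "sphere_inter x n y 2 =
    (if gdist x y = n + 2 then \<Union>w\<in>parents x y. parents x w
     else if gdist x y = n then \<Union>w\<in>parents x y. children x w - {y}
     else if n = gdist x y + 2 then \<Union>w\<in>children x y. children x w
     else {})"
proof -
  have eq: "sphere_inter x n y 2 =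
      {v. v \<noteq> y \<and> gdist x v = n \<and> (\<exists>w. (y, w) \<in> parcs T \<and> (w, v) \<in> parcs T)}"
    using gdist_eq_2_iff[OF y] in_arcsD2
    by (auto simp: sphere_inter_def graph_sphere_def)
  have "v \<in> sphere_inter x n y 2 \<longleftrightarrow> v \<in>
    (if gdist x y = n + 2 then \<Union>w\<in>parents x y. parents x w
     else if gdist x y = n then \<Union>w\<in>parents x y. children x w - {y}
     else if n = gdist x y + 2 then \<Union>w\<in>children x y. children x w
     else {})" for v
  proof
    assume "v \<in> sphere_inter x n y 2"
    then obtain w where v: "v \<noteq> y" "gdist x v = n" and w: "(y, w) \<in> parcs T" "(w, v) \<in> parcs T"
      by (auto simp: eq)
    \<comment> \<open>Excludes the down-and-up walk: otherwise \<open>v\<close> and \<open>y\<close>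
      would both be parents of \<open>w\<close>, hence equal.\<close>
    have "gdist x w < gdist x y" if "gdist x y = n"
    proof (rule ccontr)
      assume "\<not> gdist x w < gdist x y"
      then have "gdist x y < gdist x w" using adjacent_gdist[OF x w(1)] by auto
      then show False
        using parent_unique[OF x, of w y v] w arcs_symmetric v that by blast
    qed
    note up = this
    have dw: "gdist x w = Suc (gdist x y) \<or> gdist x y = Suc (gdist x w)"
      "gdist x v = Suc (gdist x w) \<or> gdist x w = Suc (gdist x v)"
      using adjacent_gdist[OF x] w by blast+
    show "v \<in> (if gdist x y = n + 2 then \<Union>w\<in>parents x y. parents x w
     else if gdist x y = n then \<Union>w\<in>parents x y. children x w - {y}
     else if n = gdist x y + 2 then \<Union>w\<in>children x y. children x w
     else {})"
    proof (cases "gdist x w < gdist x y")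
      case True
      then have wp: "w \<in> parents x y" using w dw by (auto simp: parents_def)
      show ?thesis
      proof (cases "gdist x v = Suc (gdist x w)")
        case True
        then have "v \<in> children x w - {y}" "gdist x y = n"
          using v w dw \<open>gdist x w < gdist x y\<close> by (auto simp: children_def)
        then show ?thesis using wp by auto
      next
        case False
        then have "v \<in> parents x w" "gdist x y = n + 2"
          using v w dw \<open>gdist x w < gdist x y\<close> by (auto simp: parents_def)
        then show ?thesis using wp by auto
      qed
    next
      case False
      then have "w \<in> children x y" "v \<in> children x w" "n = gdist x y + 2"
        using up v w dw by (auto simp: children_def)
      then show ?thesis by auto
    qed
  next
    assume "v \<in> (if gdist x y = n + 2 then \<Union>w\<in>parents x y. parents x w
     else if gdist x y = n then \<Union>w\<in>parents x y. children x w - {y}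
     else if n = gdist x y + 2 then \<Union>w\<in>children x y. children x w
     else {})"
    then show "v \<in> sphere_inter x n y 2"
      unfolding eq by (auto simp: parents_def children_def split: if_splits)
  qed
  then show ?thesis by blast
qed

text \<open>In the second case \<open>y = x\<close> means \<open>n = 1\<close>; the root has no
  parent to subtract, so its count is its full degree.\<close>

lemma card_sphere_inter_1:
  assumes x: "x \<in> pverts T" and y: "y \<in> pverts T"
  shows "card (sphere_inter x n y 1) =
    (if gdist x y = Suc n then 1
     else if n = Suc (gdist x y) then vertex_degree T y - (if y = x then 0 else 1) else 0)"
proof -
  have "card (parents x y) = 1" if "gdist x y = Suc n"
    using parents_nonroot[OF x y] that x by (metis card_1_singleton_iff One_nat_def gdist_self nat.distinct(1))
  then show ?thesis
    using card_children[OF x y] unfolding sphere_inter_1[OF x y] by auto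
qed

text \<open>Stated apart from \<open>card_sphere_inter_2\<close> because it involves no degrees and
  covers every \<open>n\<close>; it supplies the leading coefficients for period 2.\<close>

lemma card_sphere_inter_2_far:
  assumes x: "x \<in> pverts T" and y: "y \<in> pverts T" and d: "gdist x y = n + 2"
  shows "card (sphere_inter x n y 2) = 1"
proof -
  have "x \<noteq> y" using d x by auto
  then obtain w where w: "parents x y = {w}" using parents_nonroot[OF x y] by metis
  then have "w \<in> parents x y" by simp
  then have "gdist x w = n + 1" "w \<in> pverts T" using d in_arcsD2 by (auto simp: parents_def)
  moreover from this have "x \<noteq> w" using x by auto
  ultimately obtain v where "parents x w = {v}" using parents_nonroot[OF x, of w] by metis
  then show ?thesis by (simp add: sphere_inter_2[OF x y] d w)
qed

text \<open>The degree is prescribed only at the neighbours of \<open>y\<close>, the middle vertices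
  of the two-step walks. The bound \<open>1 < n\<close> ensures that the parent of a vertex at
  distance \<open>n\<close> is not \<open>x\<close>, which has one child more.\<close>

lemma card_sphere_inter_2:
  assumes x: "x \<in> pverts T" and y: "y \<in> pverts T"
    and q: "\<And>w. (y, w) \<in> parcs T \<Longrightarrow> vertex_degree T w = q + 1" and n: "1 < n"
  shows "card (sphere_inter x n y 2) =
    (if gdist x y = n + 2 then 1
     else if gdist x y = n then q - 1
     else if n = gdist x y + 2 then (vertex_degree T y - (if y = x then 0 else 1)) * q
     else 0)"
proof -
  have A: "card (\<Union>w\<in>parents x y. parents x w) = 1" if "gdist x y = n + 2"
    using card_sphere_inter_2_far[OF x y that] that by (simp add: sphere_inter_2[OF x y])
  have ch: "card (children x w) = q" if "(y, w) \<in> parcs T" "w \<noteq> x" for w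
    using card_children[OF x, of w] q[OF that(1)] that in_arcsD2 by auto
  have B: "card (\<Union>w\<in>parents x y. children x w - {y}) = q - 1" if d: "gdist x y = n"
  proof -
    have "x \<noteq> y" using d x n by auto
    then obtain w where w: "parents x y = {w}" using parents_nonroot[OF x y] by metis
    then have wp: "w \<in> parents x y" by simp
    then have "(y, w) \<in> parcs T" "w \<noteq> x" using d n x by (auto simp: parents_def)
    moreover have "y \<in> children x w" using wp mem_children_iff[OF x] by blast
    ultimately show ?thesis using ch w by simp
  qed
  have C: "card (\<Union>w\<in>children x y. children x w) = card (children x y) * q"
  proof -
    have "card (\<Union>w\<in>children x y. children x w) = (\<Sum>w\<in>children x y. card (children x w))"
    proof (rule card_UN_disjoint)
      \<comment> \<open>Different children of \<open>y\<close> share no child because parents are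
        unique.\<close>
      show "\<forall>i\<in>children x y. \<forall>j\<in>children x y. i \<noteq> j \<longrightarrow> children x i \<inter> children x j = {}"
      proof (intro ballI impI Int_emptyI)
        fix i j v
        assume "i \<in> children x y" "j \<in> children x y" "i \<noteq> j" "v \<in> children x i" "v \<in> children x j"
        then have "(v, i) \<in> parcs T" "(v, j) \<in> parcs T" "gdist x i < gdist x v" "gdist x i = gdist x j"
          by (auto simp: children_def arcs_symmetric)
        then show False using parent_unique[OF x] \<open>i \<noteq> j\<close> by blast
      qed
    qed (auto simp: finite_children)
    also have "\<dots> = (\<Sum>w\<in>children x y. q)"
    proof (rule sum.cong)
      fix w assume "w \<in> children x y"
      then have "(y, w) \<in> parcs T" "gdist x w \<noteq> 0" by (auto simp: children_def)
      then show "card (children x w) = q" using ch x by (metis gdist_self)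
    qed simp
    finally show ?thesis by simp
  qed
  show ?thesis
    unfolding sphere_inter_2[OF x y] using A B C card_children[OF x y] by simp
qed

end

section \<open>Hecke algebras with triangular structure constants\<close>

lemma lookup_map_mult: "Poly_Mapping.lookup (Poly_Mapping.map ((*) r) f) X = r * Poly_Mapping.lookup f X"
  for r :: "'r::comm_ring_1"
  by (simp add: map.rep_eq when_def)

text \<open>An enumeration \<open>e\<close> of the double cosets reduces the algebra to arithmetic
  with the constants \<open>c\<close>. By \<open>c_bound\<close> the product respects the filtration
  by index, and by \<open>c_step\<close> multiplication by \<open>e 1\<close> raises the index with
  leading coefficient 1. In \<open>c_assoc\<close> the range of \<open>k\<close> is cut off at any
  \<open>L\<close> beyond which \<open>c_bound\<close> leaves only zero terms.\<close>

locale enumerated_hecke_pair =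
  fixes G :: "('g, 'm) monoid_scheme" and H :: "'g set"
    and e :: "nat \<Rightarrow> 'g set" and c :: "nat \<Rightarrow> nat \<Rightarrow> nat \<Rightarrow> nat"
  assumes inj_e: "inj e"
    and double_cosets_eq: "double_cosets G H = range e"
    and e_0: "e 0 = H"
    and hecke_const_eq: "hecke_const G H (e a) (e b) (e k) = c a b k"
    and c_bound: "c a b k \<noteq> 0 \<Longrightarrow> k \<le> a + b"
    and c_unit_left: "c 0 b k = (if k = b then 1 else 0)"
    and c_unit_right: "c b 0 k = (if k = b then 1 else 0)"
    and c_step: "c 1 n (Suc n) = 1"
    and c_assoc: "a + b \<le> L \<Longrightarrow> b + d \<le> L \<Longrightarrow>
      (\<Sum>k\<le>L. c a b k * c k d l) = (\<Sum>k\<le>L. c b d k * c a k l)"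
begin

section \<open>Coefficients and products in the enumerated basis\<close>

abbreviation coeff_at :: "('g set \<Rightarrow>\<^sub>0 'r::comm_ring_1) \<Rightarrow> nat \<Rightarrow> 'r" where
  "coeff_at f n \<equiv> Poly_Mapping.lookup f (e n)"

abbreviation hmult :: "('g set \<Rightarrow>\<^sub>0 'r::comm_ring_1) \<Rightarrow> ('g set \<Rightarrow>\<^sub>0 'r) \<Rightarrow> ('g set \<Rightarrow>\<^sub>0 'r)" where
  "hmult \<equiv> hecke_mult G H"

text \<open>The analogue of having degree at most \<open>M\<close>; sums over the keys become sums
  over \<open>{..M}\<close>.\<close>

definition supported :: "nat \<Rightarrow> ('g set \<Rightarrow>\<^sub>0 'r::comm_ring_1) \<Rightarrow> bool" where
  "supported M f \<longleftrightarrow> Poly_Mapping.keys f \<subseteq> e ` {..M}"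

lemma supportedI:
  assumes "Poly_Mapping.keys f \<subseteq> range e" "\<And>n. n > M \<Longrightarrow> coeff_at f n = 0"
  shows "supported M f"
  unfolding supported_def
proof
  fix X assume X: "X \<in> Poly_Mapping.keys f"
  then obtain n where n: "X = e n" using assms(1) by blast
  then have "coeff_at f n \<noteq> 0" using X by (simp add: in_keys_iff)
  then have "n \<le> M" using assms(2) not_le by blast
  then show "X \<in> e ` {..M}" using n by simp
qed

lemma supported_coeff_at: "supported M f \<Longrightarrow> M < n \<Longrightarrow> coeff_at f n = 0"
  by (rule ccontr) (force simp: supported_def dest: injD[OF inj_e] simp flip: in_keys_iff)

lemma supported_range: "supported M f \<Longrightarrow> Poly_Mapping.keys f \<subseteq> range e"
  by (auto simp: supported_def)

lemma supported_mono: "supported M f \<Longrightarrow> M \<le> N \<Longrightarrow> supported N f"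
  unfolding supported_def by fastforce

lemma ex_supported:
  assumes "Poly_Mapping.keys f \<subseteq> range e"
  shows "\<exists>M. supported M f"
proof -
  obtain A where A: "finite A" "Poly_Mapping.keys f = e ` A"
    using finite_subset_image[OF finite_keys assms] by blast
  then have "A \<subseteq> {..Max A}" by auto
  then have "supported (Max A) f" using A by (simp add: supported_def image_mono)
  then show ?thesis ..
qed

lemma keys_add_range:
  assumes "Poly_Mapping.keys f \<subseteq> range e" "Poly_Mapping.keys g \<subseteq> range e"
  shows "Poly_Mapping.keys (f + g) \<subseteq> range e"
  using assms keys_add[of f g] by blast

lemma keys_map_range:
  fixes r :: "'r::comm_ring_1"
  shows "Poly_Mapping.keys f \<subseteq> range e \<Longrightarrow> Poly_Mapping.keys (Poly_Mapping.map ((*) r) f) \<subseteq> range e"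
proof -
  have "Poly_Mapping.keys (Poly_Mapping.map ((*) r) f) \<subseteq> Poly_Mapping.keys f"
    by (auto simp: in_keys_iff lookup_map_mult)
  then show "Poly_Mapping.keys f \<subseteq> range e \<Longrightarrow> Poly_Mapping.keys (Poly_Mapping.map ((*) r) f) \<subseteq> range e"
    by blast
qed

lemma keys_single_range: "Poly_Mapping.keys (Poly_Mapping.single (e n) r) \<subseteq> range e"
  by simp

lemma eqI:
  assumes "Poly_Mapping.keys f \<subseteq> range e" "Poly_Mapping.keys g \<subseteq> range e"
    and "\<And>n. coeff_at f n = coeff_at g n"
  shows "f = g"
proof (rule poly_mapping_eqI)
  fix X
  show "Poly_Mapping.lookup f X = Poly_Mapping.lookup g X"
  proof (cases "X \<in> range e")
    case False
    then have "X \<notin> Poly_Mapping.keys f" "X \<notin> Poly_Mapping.keys g" using assms by blast+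
    then show ?thesis by (simp add: in_keys_iff)
  qed (use assms in auto)
qed

lemma coeff_at_single: "coeff_at (Poly_Mapping.single (e n) r) k = (if k = n then r else 0)"
  using inj_e by (auto simp: lookup_single when_def inj_def)

lemma lookup_structure_sum:
  fixes r :: "'r::comm_ring_1"
  shows "Poly_Mapping.lookup (\<Sum>X\<in>{X \<in> double_cosets G H. hecke_const G H (e a) (e b) X \<noteq> 0}.
      Poly_Mapping.single X (r * of_nat (hecke_const G H (e a) (e b) X))) Y =
    (if Y \<in> range e then r * of_nat (hecke_const G H (e a) (e b) Y) else 0)"
proof -
  let ?S = "{X \<in> double_cosets G H. hecke_const G H (e a) (e b) X \<noteq> 0}"
  \<comment> \<open>A \<open>sum\<close> over an infinite index set would be 0 by convention;
    \<open>c_bound\<close> rules this out.\<close>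
  have "?S \<subseteq> e ` {..a + b}"
    using c_bound by (auto simp: double_cosets_eq hecke_const_eq)
  then have "finite ?S" using finite_subset by blast
  then show ?thesis
    by (simp add: lookup_sum lookup_single when_def double_cosets_eq)
qed

text \<open>Passing from the keys to initial segments adds only zero terms, and the coefficients of
  a product become plain double sums that can be rearranged.\<close>

lemma coeff_at_hmult:
  fixes f g :: "'g set \<Rightarrow>\<^sub>0 'r::comm_ring_1"
  assumes "supported M f" "supported N g"
  shows "coeff_at (hmult f g) l =
    (\<Sum>a\<le>M. \<Sum>b\<le>N. coeff_at f a * coeff_at g b * of_nat (c a b l))"
proof -
  let ?t = "\<lambda>D D'. Poly_Mapping.lookup f D * Poly_Mapping.lookup g D' * of_nat (hecke_const G H D D' (e l))"
  have "coeff_at (hmult f g) l = (\<Sum>D\<in>Poly_Mapping.keys f. \<Sum>D'\<in>Poly_Mapping.keys g. ?t D D')"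
    unfolding hecke_mult_def lookup_sum[of _ "Poly_Mapping.keys f"]
  proof (rule sum.cong[OF refl])
    fix D assume "D \<in> Poly_Mapping.keys f"
    then obtain a where a: "D = e a" using assms by (auto simp: supported_def)
    show "Poly_Mapping.lookup (\<Sum>D'\<in>Poly_Mapping.keys g.
        \<Sum>X\<in>{X \<in> double_cosets G H. hecke_const G H D D' X \<noteq> 0}.
          Poly_Mapping.single X (Poly_Mapping.lookup f D * Poly_Mapping.lookup g D' *
            of_nat (hecke_const G H D D' X))) (e l) = (\<Sum>D'\<in>Poly_Mapping.keys g. ?t D D')"
      unfolding lookup_sum[of _ "Poly_Mapping.keys g"]
    proof (rule sum.cong[OF refl])
      fix D' assume "D' \<in> Poly_Mapping.keys g"
      then obtain b where "D' = e b" using assms by (auto simp: supported_def)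
      then show "Poly_Mapping.lookup (\<Sum>X\<in>{X \<in> double_cosets G H. hecke_const G H D D' X \<noteq> 0}.
          Poly_Mapping.single X (Poly_Mapping.lookup f D * Poly_Mapping.lookup g D' *
            of_nat (hecke_const G H D D' X))) (e l) = ?t D D'"
        unfolding a by (simp only: lookup_structure_sum) simp
    qed
  qed
  also have "\<dots> = (\<Sum>D\<in>Poly_Mapping.keys f. \<Sum>D'\<in>e ` {..N}. ?t D D')"
    using assms(2) by (intro sum.cong sum.mono_neutral_left)
      (auto simp: supported_def in_keys_iff)
  also have "\<dots> = (\<Sum>D\<in>e ` {..M}. \<Sum>D'\<in>e ` {..N}. ?t D D')"
    using assms(1) by (intro sum.mono_neutral_left) (auto simp: supported_def in_keys_iff)
  also have "\<dots> = (\<Sum>a\<le>M. \<Sum>b\<le>N. ?t (e a) (e b))"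
    by (simp add: sum.reindex inj_on_subset[OF inj_e])
  finally show ?thesis by (simp add: hecke_const_eq)
qed

lemma keys_hmult_range:
  assumes "Poly_Mapping.keys f \<subseteq> range e" "Poly_Mapping.keys g \<subseteq> range e"
  shows "Poly_Mapping.keys (hmult f g) \<subseteq> range e"
proof
  fix Y assume "Y \<in> Poly_Mapping.keys (hmult f g)"
  then have "Poly_Mapping.lookup (hmult f g) Y \<noteq> 0" by (simp add: in_keys_iff)
  then obtain D where D: "D \<in> Poly_Mapping.keys f"
    "Poly_Mapping.lookup (\<Sum>D'\<in>Poly_Mapping.keys g.
        \<Sum>X\<in>{X \<in> double_cosets G H. hecke_const G H D D' X \<noteq> 0}.
          Poly_Mapping.single X (Poly_Mapping.lookup f D * Poly_Mapping.lookup g D' *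
            of_nat (hecke_const G H D D' X))) Y \<noteq> 0"
    unfolding hecke_mult_def lookup_sum[of _ "Poly_Mapping.keys f"] by (meson sum.neutral)
  then obtain D' where D': "D' \<in> Poly_Mapping.keys g"
    "Poly_Mapping.lookup (\<Sum>X\<in>{X \<in> double_cosets G H. hecke_const G H D D' X \<noteq> 0}.
          Poly_Mapping.single X (Poly_Mapping.lookup f D * Poly_Mapping.lookup g D' *
            of_nat (hecke_const G H D D' X))) Y \<noteq> 0"
    unfolding lookup_sum[of _ "Poly_Mapping.keys g"] by (meson sum.neutral)
  obtain a b where ab: "D = e a" "D' = e b" using D(1) D'(1) assms by blast
  show "Y \<in> range e"
    using D'(2) unfolding ab lookup_structure_sum by presburger
qed

lemma supported_hmult:
  assumes "supported M f" "supported N g"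
  shows "supported (M + N) (hmult f g)"
proof (rule supportedI)
  show "Poly_Mapping.keys (hmult f g) \<subseteq> range e"
    by (intro keys_hmult_range supported_range[OF assms(1)] supported_range[OF assms(2)])
  fix n assume n: "M + N < n"
  have "c a b n = 0" if "a \<le> M" "b \<le> N" for a b
    using c_bound[of a b n] that n by linarith
  then show "coeff_at (hmult f g) n = 0"
    by (simp add: coeff_at_hmult[OF assms])
qed

lemma
  fixes f g h :: "'g set \<Rightarrow>\<^sub>0 'r::comm_ring_1"
  assumes "Poly_Mapping.keys f \<subseteq> range e" "Poly_Mapping.keys g \<subseteq> range e" "Poly_Mapping.keys h \<subseteq> range e"
  shows hmult_add_left: "hmult (f + g) h = hmult f h + hmult g h"
    and hmult_add_right: "hmult h (f + g) = hmult h f + hmult h g"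
proof -
  obtain M1 M2 M3 where "supported M1 f" "supported M2 g" "supported M3 h"
    using assms ex_supported by meson
  \<comment> \<open>A common bound lets the sums for \<open>f\<close>, \<open>g\<close> and
    \<open>f + g\<close> run over the same range.\<close>
  then obtain M where M: "supported M f" "supported M g" "supported M h"
    using supported_mono[of _ _ "max M1 (max M2 M3)"] by (meson max.cobounded1 max.coboundedI2 max.cobounded2)
  then have fg: "supported M (f + g)"
    using assms by (intro supportedI keys_add_range) (auto simp: lookup_add supported_coeff_at)
  show "hmult (f + g) h = hmult f h + hmult g h"
    by (rule eqI)
      (use assms in \<open>simp_all add: keys_add_range keys_hmult_range lookup_add
        coeff_at_hmult[OF fg M(3)] coeff_at_hmult[OF M(1) M(3)] coeff_at_hmult[OF M(2) M(3)]
        distrib_right sum.distrib\<close>)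
  show "hmult h (f + g) = hmult h f + hmult h g"
    by (rule eqI)
      (use assms in \<open>simp_all add: keys_add_range keys_hmult_range lookup_add
        coeff_at_hmult[OF M(3) fg] coeff_at_hmult[OF M(3) M(1)] coeff_at_hmult[OF M(3) M(2)]
        distrib_left distrib_right sum.distrib\<close>)
qed

lemma hmult_map_right:
  fixes f g :: "'g set \<Rightarrow>\<^sub>0 'r::comm_ring_1"
  assumes "Poly_Mapping.keys f \<subseteq> range e" "Poly_Mapping.keys g \<subseteq> range e"
  shows "hmult f (Poly_Mapping.map ((*) r) g) = Poly_Mapping.map ((*) r) (hmult f g)"
proof -
  obtain M N where M: "supported M f" and N: "supported N g"
    using assms ex_supported by meson
  have rg: "supported N (Poly_Mapping.map ((*) r) g)"
    using assms N by (intro supportedI keys_map_range) (auto simp: lookup_map_mult supported_coeff_at)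
  show ?thesis
    by (rule eqI)
      (use assms in \<open>simp_all add: keys_map_range keys_hmult_range lookup_map_mult
        coeff_at_hmult[OF M rg] coeff_at_hmult[OF M N] sum_distrib_left mult_ac\<close>)
qed

lemma supported_single: "n \<le> M \<Longrightarrow> supported M (Poly_Mapping.single (e n) r)"
  by (auto simp: supported_def)

lemma coeff_at_hmult_single:
  fixes g :: "'g set \<Rightarrow>\<^sub>0 'r::comm_ring_1"
  assumes "supported N g"
  shows "coeff_at (hmult (Poly_Mapping.single (e n) r) g) l =
    r * (\<Sum>b\<le>N. coeff_at g b * of_nat (c n b l))"
proof -
  have "coeff_at (hmult (Poly_Mapping.single (e n) r) g) l =
      (\<Sum>a\<le>n. if a = n then r * (\<Sum>b\<le>N. coeff_at g b * of_nat (c n b l)) else 0)"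
    unfolding coeff_at_hmult[OF supported_single[OF order_refl] assms]
    by (intro sum.cong) (auto simp: coeff_at_single sum_distrib_left mult.assoc)
  then show ?thesis by simp
qed

lemma coeff_at_hmult_basis_elem:
  "coeff_at (hmult (basis_elem (e a)) (basis_elem (e b))) l = (of_nat (c a b l) :: 'r::comm_ring_1)"
proof -
  have "coeff_at (hmult (basis_elem (e a)) (basis_elem (e b))) l =
      (\<Sum>b'\<le>b. (if b' = b then of_nat (c a b' l) else 0 :: 'r))"
    using coeff_at_hmult_single[OF supported_single[of b b], of a 1 1 l]
    by (simp add: basis_elem_def coeff_at_single if_distrib[where f = "\<lambda>x. x * _"] cong: if_cong)
  then show ?thesis by simp
qed

lemma keys_single_H_range: "Poly_Mapping.keys (Poly_Mapping.single H a) \<subseteq> range e"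
  using keys_single_range[of 0 a] unfolding e_0 .

lemma hmult_unit:
  fixes g :: "'g set \<Rightarrow>\<^sub>0 'r::comm_ring_1"
  assumes "Poly_Mapping.keys g \<subseteq> range e"
  shows "hmult (Poly_Mapping.single H r) g = Poly_Mapping.map ((*) r) g"
proof -
  obtain N where N: "supported N g" using assms ex_supported by blast
  show ?thesis
  proof (rule eqI)
    fix l
    have "(\<Sum>b\<le>N. coeff_at g b * of_nat (c 0 b l)) = coeff_at g l"
      by (simp add: c_unit_left if_distrib sum.delta supported_coeff_at[OF N] cong: if_cong)
    then show "coeff_at (hmult (Poly_Mapping.single H r) g) l = coeff_at (Poly_Mapping.map ((*) r) g) l"
      using coeff_at_hmult_single[OF N, of 0 r l] by (simp add: e_0 lookup_map_mult)
  qed (use assms in \<open>simp_all add: keys_single_H_range keys_hmult_range keys_map_range del: keys_single\<close>)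
qed

text \<open>Both sides expand into fourfold sums; moving the sum over \<open>k\<close> to the
  innermost place isolates the sums compared by \<open>c_assoc\<close>.\<close>

lemma hmult_assoc:
  fixes x y z :: "'g set \<Rightarrow>\<^sub>0 'r::comm_ring_1"
  assumes "Poly_Mapping.keys x \<subseteq> range e" "Poly_Mapping.keys y \<subseteq> range e" "Poly_Mapping.keys z \<subseteq> range e"
  shows "hmult (hmult x y) z = hmult x (hmult y z)"
proof -
  obtain M1 M2 M3 where "supported M1 x" "supported M2 y" "supported M3 z"
    using assms ex_supported by meson
  then obtain M where M: "supported M x" "supported M y" "supported M z"
    using supported_mono[of _ _ "max M1 (max M2 M3)"] by (meson max.cobounded1 max.coboundedI2 max.cobounded2)
  note xy = supported_hmult[OF M(1,2)] and yz = supported_hmult[OF M(2,3)]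
  show ?thesis
  proof (rule eqI)
    fix l
    have "coeff_at (hmult (hmult x y) z) l =
      (\<Sum>k\<le>M+M. \<Sum>d\<le>M. (\<Sum>a\<le>M. \<Sum>b\<le>M. coeff_at x a * coeff_at y b * of_nat (c a b k)) *
        coeff_at z d * of_nat (c k d l))"
      by (simp add: coeff_at_hmult[OF xy M(3)] coeff_at_hmult[OF M(1,2)])
    also have "\<dots> = (\<Sum>k\<le>M+M. \<Sum>d\<le>M. \<Sum>a\<le>M. \<Sum>b\<le>M. coeff_at x a * coeff_at y b * coeff_at z d *
        of_nat (c a b k * c k d l))"
      by (simp add: sum_distrib_left sum_distrib_right mult_ac)
    also have "\<dots> = (\<Sum>d\<le>M. \<Sum>a\<le>M. \<Sum>b\<le>M. \<Sum>k\<le>M+M. coeff_at x a * coeff_at y b * coeff_at z d *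
        of_nat (c a b k * c k d l))"
      by (rule trans[OF sum.swap sum.cong[OF refl trans[OF sum.swap sum.cong[OF refl sum.swap]]]])
    also have "\<dots> = (\<Sum>d\<le>M. \<Sum>a\<le>M. \<Sum>b\<le>M. coeff_at x a * coeff_at y b * coeff_at z d *
        of_nat (\<Sum>k\<le>M+M. c a b k * c k d l))"
      by (simp only: of_nat_sum sum_distrib_left)
    \<comment> \<open>The cut-off \<open>M + M\<close> bounds both \<open>a + b\<close> and
      \<open>b + d\<close> for indices up to \<open>M\<close>, as \<open>c_assoc\<close>
      requires.\<close>
    also have "\<dots> = (\<Sum>d\<le>M. \<Sum>a\<le>M. \<Sum>b\<le>M. coeff_at x a * coeff_at y b * coeff_at z d *
        of_nat (\<Sum>k\<le>M+M. c b d k * c a k l))"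
      by (intro sum.cong refl arg_cong2[where f = "(*)"] arg_cong[where f = of_nat] c_assoc) auto
    also have "\<dots> = (\<Sum>a\<le>M. \<Sum>d\<le>M. \<Sum>b\<le>M. \<Sum>k\<le>M+M. coeff_at x a * coeff_at y b * coeff_at z d *
        of_nat (c b d k * c a k l))"
      unfolding of_nat_sum sum_distrib_left by (rule sum.swap)
    also have "\<dots> = (\<Sum>a\<le>M. \<Sum>k\<le>M+M. \<Sum>d\<le>M. \<Sum>b\<le>M. coeff_at x a * coeff_at y b * coeff_at z d *
        of_nat (c b d k * c a k l))"
      by (rule sum.cong[OF refl trans[OF sum.cong[OF refl sum.swap] sum.swap]])
    also have "\<dots> = (\<Sum>a\<le>M. \<Sum>k\<le>M+M. \<Sum>b\<le>M. \<Sum>d\<le>M. coeff_at x a * coeff_at y b * coeff_at z d *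
        of_nat (c b d k * c a k l))"
      by (rule sum.cong[OF refl sum.cong[OF refl sum.swap]])
    also have "\<dots> = coeff_at (hmult x (hmult y z)) l"
      by (simp add: coeff_at_hmult[OF M(1) yz] coeff_at_hmult[OF M(2,3)] sum_distrib_left sum_distrib_right mult_ac)
    finally show "coeff_at (hmult (hmult x y) z) l = coeff_at (hmult x (hmult y z)) l" .
  qed (use assms in \<open>simp_all add: keys_hmult_range\<close>)
qed

section \<open>Evaluation of polynomials at the generator\<close>

text \<open>Horner's scheme at \<open>basis_elem (e 1)\<close>, with
  \<open>Poly_Mapping.single H a\<close> as \<open>a\<close> times the unit. It uses only left
  products with the generator, so no ring structure has to be set up first.\<close>

definition poly_eval :: "'r::comm_ring_1 poly \<Rightarrow> ('g set \<Rightarrow>\<^sub>0 'r)" where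
  "poly_eval p = fold_coeffs (\<lambda>a x. Poly_Mapping.single H a + hmult (basis_elem (e 1)) x) p 0"

lemma hmult_zero_right: "hmult f 0 = 0"
  by (simp add: hecke_mult_def)

lemma poly_eval_0 [simp]: "poly_eval 0 = 0"
  by (simp add: poly_eval_def)

lemma poly_eval_pCons:
  "poly_eval (pCons a p) = Poly_Mapping.single H a + hmult (basis_elem (e 1)) (poly_eval p)"
\<comment> \<open>\<open>pCons 0 0\<close> is the zero polynomial, on which the fold returns its
  start value; the equation then rests on \<open>hmult_zero_right\<close>.\<close>
proof (cases "a = 0 \<and> p = 0")
  case True
  then show ?thesis by (simp add: hmult_zero_right)
next
  case False
  then show ?thesis unfolding poly_eval_def by (cases "a = 0") auto
qed

lemma keys_basis_elem_range: "Poly_Mapping.keys (basis_elem (e n)) \<subseteq> range e"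
  by (simp add: basis_elem_def)

lemma keys_poly_eval_range: "Poly_Mapping.keys (poly_eval p) \<subseteq> range e"
  by (induction p)
    (simp_all add: poly_eval_pCons keys_add_range keys_hmult_range keys_basis_elem_range keys_single_H_range
      del: One_nat_def keys_single)

lemmas carrier_simps = keys_poly_eval_range keys_add_range keys_hmult_range keys_basis_elem_range
  keys_single_H_range keys_map_range

lemma poly_eval_add: "poly_eval (p + q) = poly_eval p + poly_eval q"
  by (induction p q rule: poly_induct2)
    (simp_all add: poly_eval_pCons hmult_add_right carrier_simps single_add add_ac del: One_nat_def keys_single)

lemma map_mult_add:
  fixes f g :: "'g set \<Rightarrow>\<^sub>0 'r::comm_ring_1"
  shows "Poly_Mapping.map ((*) r) (f + g) = Poly_Mapping.map ((*) r) f + Poly_Mapping.map ((*) r) g"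
  by (rule poly_mapping_eqI) (simp add: lookup_map_mult lookup_add distrib_left)

lemma map_mult_single:
  fixes r s :: "'r::comm_ring_1"
  shows "Poly_Mapping.map ((*) r) (Poly_Mapping.single X s) = Poly_Mapping.single X (r * s)"
  by (rule poly_mapping_eqI) (simp add: lookup_map_mult lookup_single when_def)

lemma poly_eval_smult: "poly_eval (Polynomial.smult r p) = Poly_Mapping.map ((*) r) (poly_eval p)"
proof (induction p)
  case 0
  show ?case by (rule poly_mapping_eqI) (simp add: lookup_map_mult)
qed (simp add: poly_eval_pCons hmult_map_right carrier_simps map_mult_add map_mult_single del: One_nat_def keys_single)

text \<open>Induction on the left factor: the constant term acts as a scalar through
  \<open>hmult_unit\<close>, and associativity pulls out the generator.\<close>

lemma poly_eval_mult: "poly_eval (p * q) = hmult (poly_eval p) (poly_eval q)"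
proof (induction p)
  case 0
  show ?case by (simp add: hecke_mult_def)
next
  case (pCons a p)
  have "poly_eval (pCons a p * q) = poly_eval (Polynomial.smult a q) + poly_eval (pCons 0 (p * q))"
    by (simp add: poly_eval_add)
  also have "\<dots> = hmult (Poly_Mapping.single H a) (poly_eval q) +
      hmult (hmult (basis_elem (e 1)) (poly_eval p)) (poly_eval q)"
    by (simp add: poly_eval_smult hmult_unit poly_eval_pCons pCons.IH hmult_assoc carrier_simps del: One_nat_def keys_single)
  also have "\<dots> = hmult (poly_eval (pCons a p)) (poly_eval q)"
    by (simp add: poly_eval_pCons hmult_add_left carrier_simps del: One_nat_def keys_single)
  finally show ?case .
qed

text \<open>Triangularity: each Horner step raises the top index by one and, by
  \<open>c_step\<close>, keeps the top coefficient.\<close>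

lemma poly_eval_top:
  "supported (degree p) (poly_eval p) \<and> coeff_at (poly_eval p) (degree p) = lead_coeff p"
proof (induction p)
  case 0
  then show ?case by (simp add: supported_def)
next
  case (pCons a p)
  show ?case
  proof (cases "p = 0")
    case True
    then show ?thesis
      using supported_single[of 0 0 a] coeff_at_single[of 0 a 0]
      by (simp add: poly_eval_pCons hmult_zero_right e_0)
  next
    case False
    let ?d = "degree p"
    have b: "supported 1 (basis_elem (e 1) :: 'g set \<Rightarrow>\<^sub>0 'a)"
      unfolding basis_elem_def by (rule supported_single) simp
    have "supported (1 + ?d) (hmult (basis_elem (e 1)) (poly_eval p))"
      using supported_hmult[OF b] pCons.IH by blast
    then have s: "supported (Suc ?d) (poly_eval (pCons a p))"
      using supported_coeff_at[of "Suc ?d" "hmult (basis_elem (e 1)) (poly_eval p)"] coeff_at_single[of 0 a]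
      by (intro supportedI keys_poly_eval_range) (simp add: poly_eval_pCons lookup_add e_0)
    have "coeff_at (hmult (basis_elem (e 1)) (poly_eval p)) (Suc ?d) =
        (\<Sum>b\<le>?d. coeff_at (poly_eval p) b * of_nat (c 1 b (Suc ?d)))"
      using coeff_at_hmult_single[of ?d "poly_eval p" 1 1] pCons.IH by (simp add: basis_elem_def)
    \<comment> \<open>By \<open>c_bound\<close>, the index \<open>Suc ?d\<close> can be reached only
      from \<open>b = ?d\<close>.\<close>
    also have "\<dots> = (\<Sum>b\<in>{?d}. coeff_at (poly_eval p) b * of_nat (c 1 b (Suc ?d)))"
    proof (rule sum.mono_neutral_right)
      show "\<forall>b\<in>{..?d} - {?d}. coeff_at (poly_eval p) b * of_nat (c 1 b (Suc ?d)) = 0"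
      proof
        fix b assume "b \<in> {..?d} - {?d}"
        then have "c 1 b (Suc ?d) = 0" using c_bound[of 1 b "Suc ?d"] by force
        then show "coeff_at (poly_eval p) b * of_nat (c 1 b (Suc ?d)) = 0" by simp
      qed
    qed auto
    also have "\<dots> = lead_coeff p" using pCons.IH c_step by simp
    finally show ?thesis
      using s False coeff_at_single[of 0 a "Suc ?d"] by (simp add: poly_eval_pCons lookup_add e_0)
  qed
qed

text \<open>The leading coefficient of a polynomial survives as a coefficient of its image, so the
  kernel is trivial.\<close>

lemma inj_poly_eval: "inj (poly_eval :: 'r::comm_ring_1 poly \<Rightarrow> _)"
proof (rule injI)
  fix p q :: "'r poly"
  assume eq: "poly_eval p = poly_eval q"
  have "poly_eval (p - q) + poly_eval q = poly_eval p"
    by (simp flip: poly_eval_add)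
  then have "poly_eval (p - q) = 0" using eq by simp
  then have "p - q = 0" using poly_eval_top[of "p - q"] by (metis leading_coeff_0_iff lookup_zero)
  then show "p = q" by simp
qed

text \<open>Surjectivity by elimination from the top: subtracting the image of a monomial removes
  the coefficient at the highest index. \<open>N\<close> is a strict bound, so \<open>N = 0\<close>
  means \<open>f = 0\<close>.\<close>

lemma supported_in_range_poly_eval:
  fixes f :: "'g set \<Rightarrow>\<^sub>0 'r::comm_ring_1"
  assumes "Poly_Mapping.keys f \<subseteq> range e" "\<And>n. N \<le> n \<Longrightarrow> coeff_at f n = 0"
  shows "f \<in> range poly_eval"
  using assms
proof (induction N arbitrary: f)
  case 0
  then have "f = 0" by (intro eqI) auto
  then show ?case using poly_eval_0 by (metis rangeI)
next
  case (Suc N)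
  define p :: "'r poly" where "p = monom (coeff_at f N) N"
  have p: "degree p \<le> N" "coeff_at (poly_eval p) N = coeff_at f N"
  proof -
    show "degree p \<le> N" unfolding p_def by (rule degree_monom_le)
    \<comment> \<open>If the coefficient vanishes, the monomial is 0 and its degree is 0 rather than
      \<open>N\<close>, hence the case split.\<close>
    show "coeff_at (poly_eval p) N = coeff_at f N"
    proof (cases "coeff_at f N = 0")
      case False
      then have "degree p = N" unfolding p_def by (rule degree_monom_eq)
      then show ?thesis using poly_eval_top[of p] by (simp add: p_def)
    qed (simp add: p_def)
  qed
  let ?g = "f + poly_eval (- p)"
  have pn: "coeff_at (poly_eval (- p)) n = - coeff_at (poly_eval p) n" for n
  proof -
    have "poly_eval (- p) + poly_eval p = 0" by (simp flip: poly_eval_add)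
    then show ?thesis by (metis lookup_add lookup_zero eq_neg_iff_add_eq_0)
  qed
  have "?g \<in> range poly_eval"
  proof (rule Suc.IH)
    show "Poly_Mapping.keys ?g \<subseteq> range e" using Suc.prems(1) by (simp add: carrier_simps)
    fix n assume n: "N \<le> n"
    show "coeff_at ?g n = 0"
    proof (cases "n = N")
      case True
      then show ?thesis using p by (simp add: lookup_add pn)
    next
      case False
      then have "coeff_at (poly_eval p) n = 0"
        using supported_coeff_at[of "degree p" "poly_eval p" n] poly_eval_top[of p] n p(1) by auto
      then show ?thesis using Suc.prems(2)[of n] n False by (simp add: lookup_add pn)
    qed
  qed
  then obtain r where "poly_eval r = ?g" by auto
  then have "poly_eval (r + p) = f"
    by (simp add: poly_eval_add add.assoc flip: poly_eval_add[of "- p" p])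
  then show ?case by blast
qed

lemma poly_eval_algebra_iso:
  "poly_eval \<in> algebra_iso poly_algebra (hecke_algebra G H :: ('r::comm_ring_1, _) module)"
proof -
  have "range poly_eval = {f :: 'g set \<Rightarrow>\<^sub>0 'r. Poly_Mapping.keys f \<subseteq> range e}"
  proof
    show "{f :: 'g set \<Rightarrow>\<^sub>0 'r. Poly_Mapping.keys f \<subseteq> range e} \<subseteq> range poly_eval"
    proof
      fix f :: "'g set \<Rightarrow>\<^sub>0 'r" assume "f \<in> {f. Poly_Mapping.keys f \<subseteq> range e}"
      then have f: "Poly_Mapping.keys f \<subseteq> range e" by simp
      then obtain M where "supported M f" using ex_supported by blast
      then show "f \<in> range poly_eval"
        using supported_in_range_poly_eval[OF f, of "Suc M"] supported_coeff_at by (metis Suc_le_lessD)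
    qed
  qed (auto intro: subsetD[OF keys_poly_eval_range])
  moreover have "poly_eval (1 :: 'r poly) = Poly_Mapping.single H 1"
    by (simp add: one_pCons poly_eval_pCons hmult_zero_right)
  ultimately show ?thesis
    using inj_poly_eval[where ?'r = 'r]
    by (simp add: algebra_iso_def ring_iso_def ring_hom_def bij_betw_def poly_algebra_def hecke_algebra_def
        double_cosets_eq keys_poly_eval_range poly_eval_add poly_eval_mult poly_eval_smult)
qed

text \<open>Horner's scheme yields the generator times the unit, so the right unit law enters
  here.\<close>

lemma poly_eval_X: "poly_eval [:0, 1:] = (basis_elem (e 1) :: 'g set \<Rightarrow>\<^sub>0 'r::comm_ring_1)"
proof (rule eqI)
  fix l
  let ?one = "Poly_Mapping.single (e 0) 1 :: 'g set \<Rightarrow>\<^sub>0 'r"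
  have "coeff_at (hmult (basis_elem (e 1)) ?one) l = of_nat (c 1 0 l)"
    using coeff_at_hmult_single[OF supported_single[of 0 0], of 1 1 1 l]
    by (simp add: basis_elem_def coeff_at_single del: One_nat_def keys_single)
  then show "coeff_at (poly_eval [:0, 1:]) l = coeff_at (basis_elem (e 1) :: 'g set \<Rightarrow>\<^sub>0 'r) l"
    by (simp add: poly_eval_pCons hmult_zero_right e_0 basis_elem_def coeff_at_single c_unit_right
        del: One_nat_def keys_single)
qed (simp_all add: carrier_simps del: One_nat_def keys_single)

end

section \<open>Groups acting on trees\<close>

text \<open>\<open>arc_act\<close> is stated as one implication; inverse group elements supply the
  other.\<close>

locale tree_action = tree_graph T + group_action G "pverts T" \<phi>
  for T :: "'v pair_pre_digraph" and G :: "('g, 'm) monoid_scheme" (structure)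
    and \<phi> :: "'g \<Rightarrow> 'v \<Rightarrow> 'v" +
  fixes x0 :: 'v
  assumes root: "x0 \<in> pverts T"
    and arc_act: "g \<in> carrier G \<Longrightarrow> (u, v) \<in> parcs T \<Longrightarrow> (\<phi> g u, \<phi> g v) \<in> parcs T"
    and degree_ge_3: "v \<in> pverts T \<Longrightarrow> 3 \<le> vertex_degree T v"
    and moves_root: "\<exists>g\<in>carrier G. \<phi> g x0 \<noteq> x0"
    and sphere_transitive: "u \<in> graph_sphere T x0 n \<Longrightarrow> v \<in> graph_sphere T x0 n \<Longrightarrow>
      \<exists>g\<in>stabilizer G \<phi> x0. \<phi> g u = v"
begin

section \<open>The action by isometries\<close>

sublocale group G
  using group_hom group_hom.axioms(1) by auto

abbreviation K :: "'g set" where "K \<equiv> stabilizer G \<phi> x0"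
abbreviation D :: "nat \<Rightarrow> 'g set" where "D \<equiv> displacement_set G T \<phi> x0"
abbreviation S :: "nat \<Rightarrow> 'v set" where "S \<equiv> graph_sphere T x0"

lemma K_iff: "g \<in> K \<longleftrightarrow> g \<in> carrier G \<and> \<phi> g x0 = x0"
  by (simp add: stabilizer_def)

lemma act_closed: "g \<in> carrier G \<Longrightarrow> v \<in> pverts T \<Longrightarrow> \<phi> g v \<in> pverts T"
  using element_image by blast

lemma act_inv: "g \<in> carrier G \<Longrightarrow> v \<in> pverts T \<Longrightarrow> \<phi> (inv g) (\<phi> g v) = v"
  using orbit_sym_aux by blast

lemma act_inv': "g \<in> carrier G \<Longrightarrow> v \<in> pverts T \<Longrightarrow> \<phi> g (\<phi> (inv g) v) = v"
  using act_inv[of "inv g" v] by simp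

lemma relpow_act: "g \<in> carrier G \<Longrightarrow> (u, v) \<in> parcs T ^^ n \<Longrightarrow> (\<phi> g u, \<phi> g v) \<in> parcs T ^^ n"
proof (induction n arbitrary: v)
  case (Suc n)
  then obtain w where "(u, w) \<in> parcs T ^^ n" "(w, v) \<in> parcs T" by auto
  then show ?case
    using Suc.IH[of w] Suc.prems(1) arc_act relpow_Suc_I by metis
qed auto

text \<open>Walks are mapped to walks, so no group element increases distances; applied to the
  inverse, this gives equality.\<close>

lemma gdist_act:
  assumes g: "g \<in> carrier G" and V: "u \<in> pverts T" "v \<in> pverts T"
  shows "gdist (\<phi> g u) (\<phi> g v) = gdist u v"
proof (rule order.antisym)
  show "gdist (\<phi> g u) (\<phi> g v) \<le> gdist u v"
    using gdist_le[OF act_closed relpow_act[OF g relpow_gdist]] assms by blast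
  have "(\<phi> (inv g) (\<phi> g u), \<phi> (inv g) (\<phi> g v)) \<in> parcs T ^^ gdist (\<phi> g u) (\<phi> g v)"
    using assms by (intro relpow_act relpow_gdist act_closed) auto
  then show "gdist u v \<le> gdist (\<phi> g u) (\<phi> g v)"
    using assms by (simp add: act_inv gdist_le)
qed

lemma inj_on_act: "g \<in> carrier G \<Longrightarrow> inj_on (\<phi> g) (pverts T)"
  by (rule inj_prop)

lemma sphere_act:
  assumes g: "g \<in> carrier G" and x: "x \<in> pverts T"
  shows "graph_sphere T (\<phi> g x) n = \<phi> g ` graph_sphere T x n"
proof
  show "\<phi> g ` graph_sphere T x n \<subseteq> graph_sphere T (\<phi> g x) n"
    using assms by (auto simp: graph_sphere_def act_closed gdist_act)
  show "graph_sphere T (\<phi> g x) n \<subseteq> \<phi> g ` graph_sphere T x n"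
  proof
    fix v assume v: "v \<in> graph_sphere T (\<phi> g x) n"
    then have V: "v \<in> pverts T" by (simp add: graph_sphere_def)
    then have i: "\<phi> (inv g) v \<in> pverts T" "v = \<phi> g (\<phi> (inv g) v)"
      using g by (simp_all add: act_closed act_inv')
    then have "gdist x (\<phi> (inv g) v) = n"
      using v gdist_act[OF g x i(1)] by (simp add: graph_sphere_def)
    then show "v \<in> \<phi> g ` graph_sphere T x n" using i by (auto simp: graph_sphere_def)
  qed
qed

text \<open>Moving both centres by the same element keeps the count; this is what makes the
  structure constants functions of distances.\<close>

lemma card_sphere_inter_act:
  assumes g: "g \<in> carrier G" and "x \<in> pverts T" "y \<in> pverts T"
  shows "card (sphere_inter (\<phi> g x) n (\<phi> g y) m) = card (sphere_inter x n y m)"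
proof -
  have "graph_sphere T z k \<subseteq> pverts T" for z k by (auto simp: graph_sphere_def)
  then have "sphere_inter (\<phi> g x) n (\<phi> g y) m = \<phi> g ` sphere_inter x n y m"
    unfolding sphere_inter_def using assms
    by (simp add: sphere_act inj_on_image_Int[OF inj_on_act[OF g]])
  moreover have "inj_on (\<phi> g) (sphere_inter x n y m)"
    by (rule inj_on_subset[OF inj_on_act[OF g]]) (auto simp: sphere_inter_def graph_sphere_def)
  ultimately show ?thesis by (simp add: card_image)
qed

lemma vertex_degree_act:
  assumes g: "g \<in> carrier G" and v: "v \<in> pverts T"
  shows "vertex_degree T (\<phi> g v) = vertex_degree T v"
proof -
  have nb: "nbrs z = graph_sphere T z 1" if "z \<in> pverts T" for z
    using gdist_eq_1_iff[OF that] in_arcsD2 by (auto simp: nbrs_def graph_sphere_def)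
  have "inj_on (\<phi> g) (graph_sphere T v 1)"
    by (rule inj_on_subset[OF inj_on_act[OF g]]) (auto simp: graph_sphere_def)
  then show ?thesis
    using assms unfolding vertex_degree_nbrs by (simp add: nb act_closed sphere_act card_image del: One_nat_def)
qed

text \<open>Degree at least 3 leaves two children besides the parent. Hence spheres are nonempty and
  every vertex other than the root has a sibling.\<close>

lemma card_children_ge_2: "v \<in> pverts T \<Longrightarrow> 2 \<le> card (children x0 v)"
  using card_children[OF root, of v] degree_ge_3[of v] by (simp split: if_splits)

lemma sphere_nonempty: "S n \<noteq> {}"
proof (induction n)
  case 0
  then show ?case using root by (simp add: sphere_0)
next
  case (Suc n)
  then obtain v where v: "v \<in> S n" by blast
  then have "children x0 v \<noteq> {}" using card_children_ge_2[of v] by (auto simp: graph_sphere_def)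
  then show ?case using v root by (auto simp: sphere_Suc)
qed

section \<open>The orbit of the root and the number of orbits\<close>

definition Orb :: "'v set" where "Orb = orbit G \<phi> x0"

lemma Orb_iff: "v \<in> Orb \<longleftrightarrow> (\<exists>g\<in>carrier G. v = \<phi> g x0)"
  by (auto simp: Orb_def orbit_def)

lemma Orb_subset: "Orb \<subseteq> pverts T"
  using act_closed root by (auto simp: Orb_iff)

lemma root_in_Orb: "x0 \<in> Orb"
  using orbit_refl root by (simp add: Orb_def)

lemma Orb_act: "g \<in> carrier G \<Longrightarrow> v \<in> Orb \<Longrightarrow> \<phi> g v \<in> Orb"
  using root composition_rule[OF root] by (metis Orb_iff m_closed)

text \<open>The stabilizer is transitive on spheres, so a sphere that meets the orbit lies in
  it.\<close>

lemma sphere_subset_Orb: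
  assumes "v \<in> Orb" "v \<in> S n"
  shows "S n \<subseteq> Orb"
proof
  fix w assume "w \<in> S n"
  then obtain g where "g \<in> K" "\<phi> g v = w" using sphere_transitive assms by blast
  then show "w \<in> Orb" using Orb_act assms K_iff by blast
qed

text \<open>A vertex in the orbit of the root has a sibling in its sphere, hence in the orbit, and
  siblings are at distance 2.\<close>

lemma sphere_2_subset_Orb: "S 2 \<subseteq> Orb"
proof -
  obtain g where g: "g \<in> carrier G" "\<phi> g x0 \<noteq> x0" using moves_root by blast
  define u where "u = \<phi> g x0"
  have u: "u \<in> pverts T" "u \<in> Orb" "x0 \<noteq> u" using g root act_closed by (auto simp: u_def Orb_iff)
  obtain w where "parents x0 u = {w}" using parents_nonroot[OF root u(1,3)] by metis
  then have w: "w \<in> parents x0 u" by simp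
  then have W: "w \<in> pverts T" "(u, w) \<in> parcs T" using in_arcsD2 by (auto simp: parents_def)
  have "\<not> children x0 w \<subseteq> {u}"
    using card_children_ge_2[OF W(1)] card_mono[of "{u}" "children x0 w"] by auto
  then obtain v where v: "v \<in> children x0 w" "v \<noteq> u" by blast
  then have wv: "(w, v) \<in> parcs T" and V: "v \<in> pverts T" and d: "gdist x0 v = gdist x0 u"
    using w in_arcsD2 by (auto simp: children_def parents_def)
  have "u \<in> S (gdist x0 u)" "v \<in> S (gdist x0 u)" using u V d by (auto simp: graph_sphere_def)
  then have "v \<in> Orb" using sphere_subset_Orb u by blast
  moreover have "gdist u v = 2" using gdist_eq_2_iff[OF u(1) V] v W wv by blast
  then have "gdist (\<phi> (inv g) u) (\<phi> (inv g) v) = 2" using gdist_act[of "inv g"] g u V by simp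
  then have "\<phi> (inv g) v \<in> S 2"
    using g V root by (simp add: u_def act_inv graph_sphere_def act_closed)
  ultimately show ?thesis using sphere_subset_Orb Orb_act g(1) by blast
qed

text \<open>Induction by two levels: the grandparent \<open>u\<close> of \<open>v\<close> lies in
  the orbit, and moving \<open>u\<close> to \<open>x0\<close> moves \<open>v\<close> into
  \<open>S 2\<close>.\<close>

lemma even_in_Orb:
  assumes "v \<in> pverts T" "even (gdist x0 v)"
  shows "v \<in> Orb"
  using assms
proof (induction "gdist x0 v" arbitrary: v rule: less_induct)
  case less
  show ?case
  proof (cases "v = x0")
    case True
    then show ?thesis using root_in_Orb by simp
  next
    case False
    then obtain n where n: "gdist x0 v = Suc n"
      using gdist_eq_0_iff[OF root less.prems(1)] not0_implies_Suc by metis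
    with less.prems obtain m where m: "n = Suc m" by (cases n) auto
    obtain w where w: "(v, w) \<in> parcs T" "gdist x0 w = n"
      by (rule exists_parent[OF root less.prems(1) n])
    have W: "w \<in> pverts T" using w in_arcsD2 by blast
    obtain u where u: "(w, u) \<in> parcs T" "gdist x0 u = m"
      using exists_parent[OF root W, of m] w m by metis
    have U: "u \<in> pverts T" using u in_arcsD2 by blast
    have "u \<in> Orb" using less.hyps[of u] less.prems n m u U by simp
    then obtain g where g: "g \<in> carrier G" "u = \<phi> g x0" using Orb_iff by blast
    have "u \<noteq> v" using n m u by auto
    then have "gdist u v = 2"
      using gdist_eq_2_iff[OF U less.prems(1)] u w arcs_symmetric by blast
    then have "gdist (\<phi> (inv g) u) (\<phi> (inv g) v) = 2"
      using gdist_act[of "inv g"] g(1) U less.prems by simp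
    then have "\<phi> (inv g) v \<in> S 2"
      using g less.prems root by (simp add: act_inv graph_sphere_def act_closed)
    then have "\<phi> g (\<phi> (inv g) v) \<in> Orb" using sphere_2_subset_Orb Orb_act g(1) by blast
    then show ?thesis using act_inv' g(1) less.prems by simp
  qed
qed

lemma Orb_transport:
  assumes "u \<in> Orb" "v \<in> Orb"
  shows "\<exists>g\<in>carrier G. \<phi> g u = v"
proof -
  obtain g h where g: "g \<in> carrier G" "u = \<phi> g x0" and h: "h \<in> carrier G" "v = \<phi> h x0"
    using assms Orb_iff by blast
  then have "\<phi> (h \<otimes> inv g) u = v"
    using act_closed root by (simp add: composition_rule act_inv)
  then show ?thesis using g h by blast
qed

text \<open>The parent of a vertex at odd distance lies in the orbit of \<open>x0\<close>; moving it
  to \<open>x0\<close> moves the vertex into \<open>S 1\<close>, where the stabilizer is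
  transitive.\<close>

lemma odd_transport:
  assumes "u \<in> pverts T" "odd (gdist x0 u)" "v \<in> pverts T" "odd (gdist x0 v)"
  shows "\<exists>g\<in>carrier G. \<phi> g u = v"
proof -
  have *: "\<exists>g\<in>carrier G. \<phi> g z \<in> S 1" if z: "z \<in> pverts T" "odd (gdist x0 z)" for z
  proof -
    obtain n where n: "gdist x0 z = Suc n" using z(2) by (cases "gdist x0 z") auto
    obtain w where w: "(z, w) \<in> parcs T" "gdist x0 w = n"
      by (rule exists_parent[OF root z(1) n])
    have W: "w \<in> pverts T" using w in_arcsD2 by blast
    then have "w \<in> Orb" using even_in_Orb w n z by simp
    then obtain g where g: "g \<in> carrier G" "\<phi> g w = x0" using Orb_transport root_in_Orb by blast
    have "gdist w z = 1" using gdist_eq_1_iff[OF W z(1)] w arcs_symmetric by blast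
    then have "gdist x0 (\<phi> g z) = 1" using gdist_act[OF g(1) W z(1)] g by simp
    then show ?thesis using g z act_closed by (auto simp: graph_sphere_def)
  qed
  obtain g where g: "g \<in> carrier G" "\<phi> g u \<in> S 1" using * assms by blast
  obtain h where h: "h \<in> carrier G" "\<phi> h v \<in> S 1" using * assms by blast
  obtain k where k: "k \<in> carrier G" "\<phi> k (\<phi> g u) = \<phi> h v"
    using sphere_transitive g h K_iff by blast
  have "\<phi> (inv h \<otimes> (k \<otimes> g)) u = v"
    using g h k assms act_closed by (simp add: composition_rule act_inv)
  then show ?thesis using g h k by blast
qed

lemma parity_transport:
  assumes "u \<in> pverts T" "v \<in> pverts T" "even (gdist x0 u) \<longleftrightarrow> even (gdist x0 v)"
  shows "\<exists>g\<in>carrier G. \<phi> g u = v"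
  using assms odd_transport Orb_transport even_in_Orb by (cases "even (gdist x0 u)") auto

lemma semi_homogeneous: "semi_homogeneous T"
  unfolding semi_homogeneous_def
proof (intro ballI impI)
  fix u v assume V: "u \<in> pverts T" "v \<in> pverts T" and "even (gdist u v)"
  then have "even (gdist x0 u) \<longleftrightarrow> even (gdist x0 v)"
    using even_gdist_add[OF root V] by simp
  then show "vertex_degree T u = vertex_degree T v"
    using parity_transport[OF V] vertex_degree_act V(1) by metis
qed

lemma orbit_eq:
  assumes "u \<in> pverts T" "v \<in> pverts T" "g \<in> carrier G" "\<phi> g u = v"
  shows "orbit G \<phi> u = orbit G \<phi> v"
proof -
  have "v \<in> orbit G \<phi> u" "v \<in> orbit G \<phi> v" using assms orbit_refl by (auto simp: orbit_def)
  moreover have "orbit G \<phi> u \<in> orbits G (pverts T) \<phi>" "orbit G \<phi> v \<in> orbits G (pverts T) \<phi>"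
    using assms by (auto simp: orbits_def)
  ultimately show ?thesis using disjoint_union by blast
qed

text \<open>Vertices at even distance lie in \<open>Orb\<close>, and those at odd distance share the
  orbit of \<open>v1\<close>. The two may coincide, so the set on the right has one or two
  elements.\<close>

lemma orbits_eq:
  assumes "v1 \<in> S 1"
  shows "orbits G (pverts T) \<phi> = {Orb, orbit G \<phi> v1}"
proof -
  have v1: "v1 \<in> pverts T" "odd (gdist x0 v1)" using assms by (auto simp: graph_sphere_def)
  have "orbit G \<phi> v \<in> {Orb, orbit G \<phi> v1}" if v: "v \<in> pverts T" for v
  proof (cases "even (gdist x0 v)")
    case True
    then obtain g where "g \<in> carrier G" "\<phi> g x0 = v"
      using parity_transport[OF root v] root by auto
    then show ?thesis using orbit_eq[OF root v] by (simp add: Orb_def)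
  next
    case False
    then show ?thesis
      using parity_transport[OF v1(1) v] v1 orbit_eq[OF v1(1) v] by blast
  qed
  moreover have "{Orb, orbit G \<phi> v1} \<subseteq> orbits G (pverts T) \<phi>"
    using root v1 by (auto simp: orbits_def Orb_def)
  ultimately show ?thesis by (auto simp: orbits_def)
qed

lemma card_orbits: "card (orbits G (pverts T) \<phi>) \<in> {1, 2}"
proof -
  obtain v1 where "v1 \<in> S 1" using sphere_nonempty by blast
  then show ?thesis using orbits_eq[of v1] by (cases "Orb = orbit G \<phi> v1") auto
qed

text \<open>A vertex of \<open>Orb\<close> at odd distance would merge the two orbits.\<close>

lemma Orb_two_orbits:
  assumes "card (orbits G (pverts T) \<phi>) = 2" "v \<in> pverts T"
  shows "v \<in> Orb \<longleftrightarrow> 2 dvd gdist x0 v"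
proof
  assume v: "v \<in> Orb"
  show "2 dvd gdist x0 v"
  proof (rule ccontr)
    assume odd: "odd (gdist x0 v)"
    obtain v1 where v1: "v1 \<in> S 1" using sphere_nonempty by blast
    then have v1': "v1 \<in> pverts T" "odd (gdist x0 v1)" by (auto simp: graph_sphere_def)
    then obtain g where "g \<in> carrier G" "\<phi> g v = v1" using odd_transport assms odd by blast
    then have "orbit G \<phi> v = orbit G \<phi> v1" by (rule orbit_eq[OF assms(2) v1'(1)])
    moreover have "orbit G \<phi> x0 = orbit G \<phi> v"
      using v orbit_eq[OF root assms(2)] Orb_iff by auto
    ultimately show False using assms(1) orbits_eq[OF v1] by (simp add: Orb_def)
  qed
qed (use even_in_Orb assms in blast)

lemma transitive_Orb:
  "transitive_action G (pverts T) \<phi> \<Longrightarrow> v \<in> pverts T \<Longrightarrow> v \<in> Orb"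
  using transitive_action.unique_orbit root Orb_iff by metis

text \<open>By \<open>card_orbits\<close> the hypothesis means a single orbit; it is phrased as the
  second half of a case distinction.\<close>

lemma Orb_one_orbit:
  assumes "card (orbits G (pverts T) \<phi>) \<noteq> 2" "v \<in> pverts T"
  shows "v \<in> Orb"
proof -
  have "card (orbits G (pverts T) \<phi>) = 1" using card_orbits assms(1) by blast
  moreover have "orbit G \<phi> v \<in> orbits G (pverts T) \<phi>" "Orb \<in> orbits G (pverts T) \<phi>"
    using assms(2) root by (auto simp: orbits_def Orb_def)
  ultimately have "orbit G \<phi> v = Orb" by (metis card_1_singletonE singletonD)
  then show ?thesis using orbit_refl assms(2) by blast
qed

lemma transitive_homogeneous:
  "transitive_action G (pverts T) \<phi> \<Longrightarrow> homogeneous T"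
  unfolding homogeneous_def using transitive_action.unique_orbit vertex_degree_act by metis

end

text \<open>The period of the orbit is 1 for a transitive action and 2 for two orbits.\<close>

locale tree_action_period = tree_action +
  fixes s :: nat
  assumes s: "s \<in> {1, 2}"
    and Orb_dvd: "v \<in> pverts T \<Longrightarrow> v \<in> Orb \<longleftrightarrow> s dvd gdist x0 v"
begin

section \<open>Cosets as vertices, double cosets as spheres\<close>

lemma s_pos: "0 < s" using s by auto

text \<open>Left multiplication of \<open>g\<close> by \<open>k\<close> in \<open>K\<close> leaves
  \<open>\<phi> (inv g) x0\<close> unchanged, as
  \<open>inv (k \<otimes> g) = inv g \<otimes> inv k\<close>. Right cosets are the fibres of this
  map, which is why inverses appear throughout.\<close>

lemma rcoset_eq:
  assumes g: "g \<in> carrier G"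
  shows "K #> g = {h \<in> carrier G. \<phi> (inv h) x0 = \<phi> (inv g) x0}"
proof
  show "K #> g \<subseteq> {h \<in> carrier G. \<phi> (inv h) x0 = \<phi> (inv g) x0}"
  proof
    fix h assume "h \<in> K #> g"
    then obtain k where k: "k \<in> carrier G" "\<phi> k x0 = x0" and h: "h = k \<otimes> g"
      by (auto simp: r_coset_def K_iff)
    have "\<phi> (inv k) x0 = x0" using k act_inv root by metis
    then show "h \<in> {h \<in> carrier G. \<phi> (inv h) x0 = \<phi> (inv g) x0}"
      using k g h root by (simp add: inv_mult_group composition_rule)
  qed
  show "{h \<in> carrier G. \<phi> (inv h) x0 = \<phi> (inv g) x0} \<subseteq> K #> g"
  proof
    fix h assume "h \<in> {h \<in> carrier G. \<phi> (inv h) x0 = \<phi> (inv g) x0}"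
    then have h: "h \<in> carrier G" "\<phi> (inv h) x0 = \<phi> (inv g) x0" by auto
    then have "\<phi> (h \<otimes> inv g) x0 = x0"
      using g root by (simp add: composition_rule act_inv' flip: h(2))
    then have "h \<otimes> inv g \<in> K" using g h by (simp add: K_iff)
    moreover have "h = h \<otimes> inv g \<otimes> g" using g h by (simp add: m_assoc)
    ultimately show "h \<in> K #> g" by (auto simp: r_coset_def)
  qed
qed

text \<open>Applying \<open>inv g\<close> to both points turns the displacement of \<open>x0\<close>
  under \<open>g\<close> into the one under \<open>inv g\<close>.\<close>

lemma D_iff: "g \<in> D n \<longleftrightarrow> g \<in> carrier G \<and> \<phi> (inv g) x0 \<in> S n"
proof -
  have "gdist (\<phi> g x0) x0 = gdist x0 (\<phi> (inv g) x0)" if g: "g \<in> carrier G"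
    using gdist_act[of "inv g" "\<phi> g x0" x0] that root act_closed by (simp add: act_inv)
  then show ?thesis using act_closed root by (auto simp: displacement_set_def graph_sphere_def)
qed

text \<open>Right multiplication by \<open>k\<close> in \<open>K\<close> moves the vertex
  \<open>\<phi> (inv g) x0\<close> by \<open>inv k\<close>, which preserves its sphere; transitivity
  on spheres gives the other inclusion.\<close>

lemma double_coset_eq:
  assumes g: "g \<in> carrier G"
  shows "double_coset G K g = D (gdist x0 (\<phi> (inv g) x0))"
proof
  let ?n = "gdist x0 (\<phi> (inv g) x0)"
  show "double_coset G K g \<subseteq> D ?n"
  proof
    fix x assume "x \<in> double_coset G K g"
    then obtain h k where h: "h \<in> carrier G" "\<phi> (inv h) x0 = \<phi> (inv g) x0"
      and k: "k \<in> carrier G" "\<phi> k x0 = x0" and x: "x = h \<otimes> k"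
      by (auto simp: double_coset_def set_mult_def rcoset_eq[OF g] K_iff)
    have "\<phi> (inv k) x0 = x0" using k act_inv root by metis
    then have "gdist x0 (\<phi> (inv x) x0) = gdist (\<phi> (inv k) x0) (\<phi> (inv k) (\<phi> (inv g) x0))"
      using h k x root by (simp add: inv_mult_group composition_rule)
    also have "\<dots> = ?n" using gdist_act k g root act_closed by simp
    finally show "x \<in> D ?n" using h k x root act_closed by (simp add: D_iff graph_sphere_def)
  qed
  show "D ?n \<subseteq> double_coset G K g"
  proof
    fix x assume "x \<in> D ?n"
    then have x: "x \<in> carrier G" "\<phi> (inv x) x0 \<in> S ?n" by (simp_all add: D_iff)
    have "\<phi> (inv g) x0 \<in> S ?n" using g root act_closed by (simp add: graph_sphere_def)
    then obtain k where k: "k \<in> K" "\<phi> k (\<phi> (inv x) x0) = \<phi> (inv g) x0"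
      using sphere_transitive x(2) by blast
    then have kc: "k \<in> carrier G" by (simp add: K_iff)
    have "\<phi> (inv (x \<otimes> inv k)) x0 = \<phi> (inv g) x0"
      using k kc x root by (simp add: inv_mult_group composition_rule)
    then have "x \<otimes> inv k \<in> K #> g" using kc x by (simp add: rcoset_eq[OF g])
    moreover have "x = x \<otimes> inv k \<otimes> k" using x kc by (simp add: m_assoc)
    ultimately show "x \<in> double_coset G K g"
      using k(1) unfolding double_coset_def set_mult_def by blast
  qed
qed

lemma sphere_inv_act:
  assumes "s dvd n" "v \<in> S n"
  obtains g where "g \<in> carrier G" "\<phi> (inv g) x0 = v"
proof -
  have "v \<in> Orb" using assms Orb_dvd by (auto simp: graph_sphere_def)
  then obtain g where "g \<in> carrier G" "v = \<phi> g x0" using Orb_iff by blast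
  then show ?thesis using that[of "inv g"] by simp
qed

lemma D_nonempty:
  assumes "s dvd n"
  shows "D n \<noteq> {}"
proof -
  obtain v where "v \<in> S n" using sphere_nonempty by blast
  then show ?thesis using sphere_inv_act[OF assms] D_iff by (metis empty_iff)
qed

lemma double_cosets_D: "double_cosets G K = range (\<lambda>n. D (s * n))"
proof
  show "double_cosets G K \<subseteq> range (\<lambda>n. D (s * n))"
  proof
    fix X assume "X \<in> double_cosets G K"
    then obtain g where g: "g \<in> carrier G" "X = D (gdist x0 (\<phi> (inv g) x0))"
      unfolding double_cosets_def using double_coset_eq by auto
    then have "\<phi> (inv g) x0 \<in> Orb" by (auto simp: Orb_iff)
    then have "s dvd gdist x0 (\<phi> (inv g) x0)" using Orb_dvd Orb_subset by blast
    then show "X \<in> range (\<lambda>n. D (s * n))" using g by (auto elim: dvdE)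
  qed
  show "range (\<lambda>n. D (s * n)) \<subseteq> double_cosets G K"
  proof
    fix X assume "X \<in> range (\<lambda>n. D (s * n))"
    then obtain n where X: "X = D (s * n)" by blast
    then obtain g where "g \<in> D (s * n)" using D_nonempty[of "s * n"] by auto
    then have "g \<in> carrier G" "gdist x0 (\<phi> (inv g) x0) = s * n"
      by (auto simp: D_iff graph_sphere_def)
    then show "X \<in> double_cosets G K"
      unfolding double_cosets_def X using double_coset_eq by (metis imageI)
  qed
qed

text \<open>One group element is chosen for each vertex of the sphere; finiteness of spheres thus
  yields the Hecke pair property.\<close>

lemma ex_coset_reps:
  assumes "s dvd n"
  shows "\<exists>R. finite R \<and> coset_reps G K (D n) R"
proof -
  have "\<exists>g. g \<in> carrier G \<and> \<phi> (inv g) x0 = v" if "v \<in> S n" for v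
    using sphere_inv_act[OF assms that] by blast
  then obtain r where r: "\<And>v. v \<in> S n \<Longrightarrow> r v \<in> carrier G \<and> \<phi> (inv (r v)) x0 = v" by metis
  then have "D n = (\<Union>v\<in>S n. K #> r v)"
    by (auto simp: D_iff rcoset_eq)
  moreover have "disjoint_family_on (\<lambda>x. K #> x) (r ` S n)"
    unfolding disjoint_family_on_def using r by (auto simp: rcoset_eq)
  ultimately have "coset_reps G K (D n) (r ` S n)"
    unfolding coset_reps_def using r by auto
  then show ?thesis using finite_sphere root by blast
qed

text \<open>Whatever representatives \<open>SOME\<close> selects in \<open>hecke_coeff\<close>, they
  correspond to the vertices of the sphere, so the count does not depend on the choice.\<close>

lemma coset_reps_bij:
  assumes "s dvd n" "coset_reps G K (D n) R"
  shows "bij_betw (\<lambda>r. \<phi> (inv r) x0) R (S n)"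
proof -
  have R: "R \<subseteq> carrier G" and Dn: "D n = (\<Union>r\<in>R. K #> r)"
    and disj: "disjoint_family_on (\<lambda>r. K #> r) R"
    using assms(2) by (auto simp: coset_reps_def)
  have self: "r \<in> K #> r" if "r \<in> R" for r using R that rcoset_eq[of r] by blast
  have "inj_on (\<lambda>r. \<phi> (inv r) x0) R"
  proof (rule inj_onI)
    fix r r' assume r: "r \<in> R" "r' \<in> R" "\<phi> (inv r) x0 = \<phi> (inv r') x0"
    then have "r \<in> K #> r'" using R rcoset_eq[of r'] by blast
    then show "r = r'" using self[OF r(1)] disj r unfolding disjoint_family_on_def by blast
  qed
  moreover have "(\<lambda>r. \<phi> (inv r) x0) ` R = S n"
  proof
    show "(\<lambda>r. \<phi> (inv r) x0) ` R \<subseteq> S n" using self Dn D_iff by blast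
    show "S n \<subseteq> (\<lambda>r. \<phi> (inv r) x0) ` R"
    proof
      fix v assume v: "v \<in> S n"
      then obtain g where g: "g \<in> carrier G" "\<phi> (inv g) x0 = v" by (rule sphere_inv_act[OF assms(1)])
      then have "g \<in> D n" using v by (simp add: D_iff)
      then obtain r where r: "r \<in> R" "g \<in> K #> r" using Dn by blast
      then have "\<phi> (inv r) x0 = v" using R rcoset_eq[of r] g by auto
      then show "v \<in> (\<lambda>r. \<phi> (inv r) x0) ` R" using r by blast
    qed
  qed
  ultimately show ?thesis by (simp add: bij_betw_def)
qed

lemma hecke_pair: "hecke_pair G K"
  unfolding hecke_pair_def
proof (intro conjI ballI)
  show "group G" by (rule group_axioms)
  show "subgroup K G" using stabilizer_subgroup root by blast
  fix g assume g: "g \<in> carrier G"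
  then have "double_coset G K g \<in> range (\<lambda>n. D (s * n))"
    using double_cosets_D by (auto simp: double_cosets_def)
  then obtain n where n: "double_coset G K g = D (s * n)" by blast
  show "\<exists>F. finite F \<and> F \<subseteq> carrier G \<and> double_coset G K g = (\<Union>x\<in>F. K #> x)"
    using ex_coset_reps[of "s * n"] unfolding n coset_reps_def by auto
qed

text \<open>Put \<open>y = \<phi> (inv x) x0\<close>. The product \<open>a \<otimes> b\<close> lies
  in the coset of \<open>x\<close> iff \<open>\<phi> (inv a) x0 = \<phi> b y\<close>. So a pair is
  determined by the vertex \<open>\<phi> (inv b) x0\<close>, and a suitable \<open>a\<close> exists
  iff this vertex has distance \<open>m\<close> from \<open>y\<close>.\<close>

lemma hecke_coeff_eq:
  assumes m: "s dvd m" and n: "s dvd n" and x: "x \<in> carrier G"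
  shows "hecke_coeff G K (D m) (D n) x = card (sphere_inter x0 n (\<phi> (inv x) x0) m)"
proof -
  define R where "R = (SOME R. coset_reps G K (D m) R)"
  define R' where "R' = (SOME R. coset_reps G K (D n) R)"
  let ?f = "\<lambda>r. \<phi> (inv r) x0"
  let ?y = "\<phi> (inv x) x0"
  have cr: "coset_reps G K (D m) R" "coset_reps G K (D n) R'"
    using ex_coset_reps[OF m] ex_coset_reps[OF n] unfolding R_def R'_def by (metis someI_ex)+
  then have R: "R \<subseteq> carrier G" "R' \<subseteq> carrier G" by (auto simp: coset_reps_def)
  have bR: "bij_betw ?f R (S m)" and bR': "bij_betw ?f R' (S n)"
    using coset_reps_bij m n cr by auto
  have y: "?y \<in> pverts T" using x root act_closed by simp
  let ?P = "{(a, b). a \<in> R \<and> b \<in> R' \<and> a \<otimes> b \<in> K #> x}"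
  have P: "(a, b) \<in> ?P \<longleftrightarrow> a \<in> R \<and> b \<in> R' \<and> ?f a = \<phi> b ?y" for a b
  proof -
    have "a \<otimes> b \<in> K #> x \<longleftrightarrow> ?f a = \<phi> b ?y" if "a \<in> carrier G" "b \<in> carrier G"
    proof -
      have "a \<otimes> b \<in> K #> x \<longleftrightarrow> \<phi> (inv b) (?f a) = ?y"
        using that x root by (simp add: rcoset_eq inv_mult_group composition_rule)
      also have "\<dots> \<longleftrightarrow> ?f a = \<phi> b ?y"
        using that y root act_closed by (metis act_inv act_inv' inv_closed)
      finally show ?thesis .
    qed
    then show ?thesis using R by auto
  qed
  have "bij_betw (\<lambda>(a, b). ?f b) ?P (sphere_inter x0 n ?y m)"
  proof (rule bij_betw_imageI)
    show "inj_on (\<lambda>(a, b). ?f b) ?P"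
    proof (rule inj_onI)
      fix p p' assume p: "p \<in> ?P" "p' \<in> ?P" "(\<lambda>(a, b). ?f b) p = (\<lambda>(a, b). ?f b) p'"
      obtain a b where ab: "p = (a, b)" by (cases p)
      obtain a' b' where ab': "p' = (a', b')" by (cases p')
      have "b = b'" using p bR' unfolding ab ab' P bij_betw_def inj_on_def by auto
      moreover from this have "?f a = ?f a'" using p unfolding ab ab' P by simp
      then have "a = a'" using p bR unfolding ab ab' P bij_betw_def inj_on_def by auto
      ultimately show "p = p'" using ab ab' by simp
    qed
    \<comment> \<open>Since \<open>b\<close> carries \<open>?f b\<close> to \<open>x0\<close>, this
      compares a distance with its image under \<open>b\<close>.\<close>
    have dist: "gdist x0 (\<phi> b ?y) = gdist ?y (?f b)" if "b \<in> carrier G" for b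
    proof -
      have "gdist x0 (\<phi> b ?y) = gdist (\<phi> b (?f b)) (\<phi> b ?y)"
        using that root by (simp add: act_inv')
      also have "\<dots> = gdist (?f b) ?y" using gdist_act that y root act_closed by simp
      finally show ?thesis using gdist_sym that y root act_closed by simp
    qed
    show "(\<lambda>(a, b). ?f b) ` ?P = sphere_inter x0 n ?y m"
    proof
      show "(\<lambda>(a, b). ?f b) ` ?P \<subseteq> sphere_inter x0 n ?y m"
      proof
        fix v assume "v \<in> (\<lambda>(a, b). ?f b) ` ?P"
        then obtain a b where ab: "(a, b) \<in> ?P" "v = ?f b" by auto
        then have P': "a \<in> R" "b \<in> R'" "?f a = \<phi> b ?y" unfolding P by auto
        then have "?f a \<in> S m" "?f b \<in> S n" using bij_betw_apply[OF bR] bij_betw_apply[OF bR'] by blast+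
        moreover have "gdist x0 (?f a) = gdist ?y (?f b)" using dist P' R by auto
        ultimately show "v \<in> sphere_inter x0 n ?y m"
          using ab(2) by (simp add: sphere_inter_def graph_sphere_def)
      qed
      show "sphere_inter x0 n ?y m \<subseteq> (\<lambda>(a, b). ?f b) ` ?P"
      proof
        fix v assume "v \<in> sphere_inter x0 n ?y m"
        then have v: "v \<in> S n" "gdist ?y v = m" by (auto simp: sphere_inter_def graph_sphere_def)
        then have "v \<in> ?f ` R'" using bij_betw_imp_surj_on[OF bR'] by simp
        then obtain b where b: "b \<in> R'" "?f b = v" by blast
        then have bc: "b \<in> carrier G" using R by blast
        have "gdist x0 (\<phi> b ?y) = m" using dist[OF bc] b v by simp
        then have "\<phi> b ?y \<in> S m" using act_closed[OF bc y] by (simp add: graph_sphere_def)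
        then have "\<phi> b ?y \<in> ?f ` R" using bij_betw_imp_surj_on[OF bR] by simp
        then obtain a where "a \<in> R" "?f a = \<phi> b ?y" by force
        then have "(a, b) \<in> ?P" using b P by blast
        then show "v \<in> (\<lambda>(a, b). ?f b) ` ?P" using b by force
      qed
    qed
  qed
  then have "card ?P = card (sphere_inter x0 n ?y m)" by (rule bij_betw_same_card)
  then show ?thesis by (simp add: hecke_coeff_def flip: R_def R'_def)
qed

section \<open>Structure constants as counts of vertices\<close>

text \<open>For multiples of \<open>s\<close>, the coefficient of \<open>D k\<close> in the product
  of \<open>D m\<close> and \<open>D n\<close>. By \<open>N_eq\<close> every vertex of
  \<open>S k\<close> gives the same count.\<close>

definition N :: "nat \<Rightarrow> nat \<Rightarrow> nat \<Rightarrow> nat" where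
  "N m n k = card (sphere_inter x0 n (SOME y. y \<in> S k) m)"

lemma N_eq:
  assumes "y \<in> S k"
  shows "N m n k = card (sphere_inter x0 n y m)"
proof -
  define z where "z = (SOME y. y \<in> S k)"
  have z: "z \<in> S k" unfolding z_def using assms by (rule someI)
  then obtain g where g: "g \<in> K" "\<phi> g z = y" using sphere_transitive assms by blast
  then have "card (sphere_inter (\<phi> g x0) n (\<phi> g z) m) = card (sphere_inter x0 n z m)"
    using z root by (intro card_sphere_inter_act) (auto simp: K_iff graph_sphere_def)
  then show ?thesis using g by (simp add: N_def K_iff flip: z_def)
qed

lemma hecke_const_N:
  assumes "s dvd m" "s dvd n" "s dvd k"
  shows "hecke_const G K (D m) (D n) (D k) = N m n k"
proof -
  define x where "x = (SOME x. x \<in> D k)"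
  have "x \<in> D k" unfolding x_def using D_nonempty[OF assms(3)] by (simp add: some_in_eq)
  then have x: "x \<in> carrier G" "\<phi> (inv x) x0 \<in> S k" by (simp_all add: D_iff)
  then show ?thesis
    using hecke_coeff_eq[OF assms(1,2) x(1)] N_eq[OF x(2)] by (simp add: hecke_const_def flip: x_def)
qed

lemma N_bound: "N m n k \<noteq> 0 \<Longrightarrow> k \<le> n + m"
proof -
  assume "N m n k \<noteq> 0"
  obtain y where y: "y \<in> S k" using sphere_nonempty by blast
  then have "sphere_inter x0 n y m \<noteq> {}" using \<open>N m n k \<noteq> 0\<close> N_eq by force
  then show ?thesis using sphere_inter_nonempty_le[OF root, of y n m] y by (auto simp: graph_sphere_def)
qed

text \<open>Moving the centre \<open>w\<close> to the root allows counts around intermediate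
  vertices of a path, as associativity requires.\<close>

lemma card_sphere_inter_N:
  assumes "w \<in> Orb" "y \<in> pverts T"
  shows "card (sphere_inter w n y m) = N m n (gdist y w)"
proof -
  obtain g where g: "g \<in> carrier G" "\<phi> g w = x0" using Orb_transport root_in_Orb assms by blast
  have w: "w \<in> pverts T" using assms Orb_subset by blast
  have "gdist x0 (\<phi> g y) = gdist y w"
    using gdist_act[OF g(1) w assms(2)] g gdist_sym w assms by simp
  then have "\<phi> g y \<in> S (gdist y w)" using act_closed g assms by (simp add: graph_sphere_def)
  then show ?thesis
    using N_eq card_sphere_inter_act[OF g(1) w assms(2)] g by metis
qed

text \<open>The sum over \<open>A\<close> is grouped by the value of \<open>f\<close>. All values
  are multiples of \<open>s\<close>, and those beyond \<open>s * L\<close> carry weight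
  zero.\<close>

lemma sum_card_fibres:
  fixes F :: "nat \<Rightarrow> nat"
  assumes A: "finite A" and f: "\<And>a. a \<in> A \<Longrightarrow> s dvd f a"
    and F: "\<And>a. a \<in> A \<Longrightarrow> F (f a) \<noteq> 0 \<Longrightarrow> f a \<le> s * L"
  shows "(\<Sum>k\<le>L. F (s * k) * card {a \<in> A. f a = s * k}) = (\<Sum>a\<in>A. F (f a))"
proof -
  have "(\<Sum>k\<le>L. F (s * k) * card {a \<in> A. f a = s * k}) =
      (\<Sum>k\<le>L. \<Sum>a\<in>A. if f a = s * k then F (s * k) else 0)"
    by (simp add: sum.inter_filter[OF A, symmetric] mult.commute)
  also have "\<dots> = (\<Sum>a\<in>A. \<Sum>k\<le>L. if f a = s * k then F (s * k) else 0)"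
    by (rule sum.swap)
  also have "\<dots> = (\<Sum>a\<in>A. F (f a))"
  proof (rule sum.cong[OF refl])
    fix a assume a: "a \<in> A"
    obtain t where t: "f a = s * t" using f[OF a] by blast
    have "(\<Sum>k\<le>L. if f a = s * k then F (s * k) else 0) = (\<Sum>k\<le>L. if k = t then F (s * t) else 0)"
      using s_pos by (intro sum.cong) (auto simp: t)
    then show "(\<Sum>k\<le>L. if f a = s * k then F (s * k) else 0) = F (f a)"
      using F[OF a] s_pos by (auto simp: t)
  qed
  finally show ?thesis .
qed

text \<open>Both sides count the paths from \<open>x0\<close> to a vertex of the sphere of radius \<open>l\<close> whose three
  steps have lengths \<open>d\<close>, \<open>b\<close> and \<open>a\<close>.\<close>

lemma N_assoc:
  assumes "a + b \<le> L" "b + d \<le> L"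
  shows "(\<Sum>k\<le>L. N (s * a) (s * b) (s * k) * N (s * k) (s * d) (s * l)) =
    (\<Sum>k\<le>L. N (s * b) (s * d) (s * k) * N (s * a) (s * k) (s * l))"
proof -
  obtain y where y: "y \<in> S (s * l)" using sphere_nonempty by blast
  have Y: "y \<in> pverts T" "y \<in> Orb" using y Orb_dvd by (auto simp: graph_sphere_def)
  let ?A = "S (s * d)" and ?B = "graph_sphere T y (s * a)"
  have A_Orb: "w \<in> pverts T \<and> w \<in> Orb" if "w \<in> ?A" for w
    using that Orb_dvd by (auto simp: graph_sphere_def)
  have B_Orb: "v \<in> pverts T \<and> v \<in> Orb" if "v \<in> ?B" for v
  proof -
    obtain g where g: "g \<in> carrier G" "\<phi> g y = x0" using Orb_transport root_in_Orb Y by blast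
    have v: "v \<in> pverts T" "gdist y v = s * a" using that by (auto simp: graph_sphere_def)
    then have "gdist x0 (\<phi> g v) = s * a" using gdist_act[OF g(1) Y(1) v(1)] g by simp
    then have "\<phi> g v \<in> Orb" using Orb_dvd[of "\<phi> g v"] act_closed g v by simp
    then have "\<phi> (inv g) (\<phi> g v) \<in> Orb" using Orb_act g by simp
    then show ?thesis using act_inv g v by simp
  qed
  have dvd: "s dvd gdist u w" if uw: "u \<in> Orb" "w \<in> Orb" for u w
  proof -
    obtain g where g: "g \<in> carrier G" "\<phi> g u = x0" using Orb_transport root_in_Orb uw by blast
    have "u \<in> pverts T" "w \<in> pverts T" using uw Orb_subset by auto
    moreover have "\<phi> g w \<in> Orb" using g uw Orb_act by blast
    ultimately show ?thesis using gdist_act[OF g(1)] g Orb_dvd Orb_subset by (metis subsetD)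
  qed
  have "(\<Sum>k\<le>L. N (s * a) (s * b) (s * k) * N (s * k) (s * d) (s * l)) =
      (\<Sum>k\<le>L. N (s * a) (s * b) (s * k) * card {w \<in> ?A. gdist y w = s * k})"
    by (intro sum.cong refl arg_cong2[where f = "(*)"])
      (simp add: N_eq[OF y] sphere_inter_def graph_sphere_def Collect_conj_eq Int_commute Int_left_commute)
  also have "\<dots> = (\<Sum>w\<in>?A. N (s * a) (s * b) (gdist y w))"
  proof (rule sum_card_fibres)
    fix w assume w: "w \<in> ?A"
    show "s dvd gdist y w" using dvd A_Orb[OF w] Y by blast
    assume "N (s * a) (s * b) (gdist y w) \<noteq> 0"
    then have "gdist y w \<le> s * (a + b)" using N_bound by (fastforce simp: distrib_left add.commute)
    also have "\<dots> \<le> s * L" using assms by simp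
    finally show "gdist y w \<le> s * L" .
  qed (simp add: finite_sphere root)
  also have "\<dots> = (\<Sum>w\<in>?A. card {v \<in> ?B. gdist w v = s * b})"
  proof (rule sum.cong[OF refl])
    fix w assume w: "w \<in> ?A"
    have "N (s * a) (s * b) (gdist y w) = card (sphere_inter w (s * b) y (s * a))"
      using card_sphere_inter_N A_Orb[OF w] Y by simp
    also have "sphere_inter w (s * b) y (s * a) = {v \<in> ?B. gdist w v = s * b}"
      by (auto simp: sphere_inter_def graph_sphere_def)
    finally show "N (s * a) (s * b) (gdist y w) = card {v \<in> ?B. gdist w v = s * b}" .
  qed
  also have "\<dots> = (\<Sum>w\<in>?A. \<Sum>v\<in>?B. if gdist w v = s * b then 1 else 0)"
    by (simp add: sum.inter_filter[symmetric] finite_sphere Y)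
  \<comment> \<open>Here \<open>w\<close> ends the first step from \<open>x0\<close> and
    \<open>v\<close> starts the last step to \<open>y\<close>. After the interchange the index
    \<open>k\<close> measures the distance from \<open>x0\<close> to \<open>v\<close> instead of
    that from \<open>y\<close> to \<open>w\<close>.\<close>
  also have "\<dots> = (\<Sum>v\<in>?B. \<Sum>w\<in>?A. if gdist w v = s * b then 1 else 0)"
    by (rule sum.swap)
  also have "\<dots> = (\<Sum>v\<in>?B. card {w \<in> ?A. gdist w v = s * b})"
    by (simp add: sum.inter_filter[symmetric] finite_sphere root)
  also have "\<dots> = (\<Sum>v\<in>?B. N (s * b) (s * d) (gdist x0 v))"
  proof (rule sum.cong[OF refl])
    fix v assume v: "v \<in> ?B"
    have V: "v \<in> pverts T" using B_Orb[OF v] by blast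
    have "{w \<in> ?A. gdist w v = s * b} = sphere_inter x0 (s * d) v (s * b)"
      using gdist_sym[OF V] by (auto simp: sphere_inter_def graph_sphere_def)
    then show "card {w \<in> ?A. gdist w v = s * b} = N (s * b) (s * d) (gdist x0 v)"
      using N_eq[of v "gdist x0 v"] V by (simp add: graph_sphere_def)
  qed
  also have "\<dots> = (\<Sum>k\<le>L. N (s * b) (s * d) (s * k) * card {v \<in> ?B. gdist x0 v = s * k})"
  proof (rule sum_card_fibres[symmetric])
    fix v assume v: "v \<in> ?B"
    show "s dvd gdist x0 v" using dvd B_Orb[OF v] root_in_Orb by blast
    assume "N (s * b) (s * d) (gdist x0 v) \<noteq> 0"
    then have "gdist x0 v \<le> s * (b + d)" using N_bound by (fastforce simp: distrib_left add.commute)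
    also have "\<dots> \<le> s * L" using assms by simp
    finally show "gdist x0 v \<le> s * L" .
  qed (simp add: finite_sphere Y)
  also have "\<dots> = (\<Sum>k\<le>L. N (s * b) (s * d) (s * k) * N (s * a) (s * k) (s * l))"
    by (intro sum.cong refl arg_cong2[where f = "(*)"])
      (simp add: N_eq[OF y] sphere_inter_def graph_sphere_def Collect_conj_eq Int_commute Int_left_commute)
  finally show ?thesis .
qed

lemma N_unit_left: "N 0 n k = (if k = n then 1 else 0)"
proof -
  obtain y where y: "y \<in> S k" using sphere_nonempty by blast
  then have "graph_sphere T y 0 = {y}" by (intro sphere_0) (simp add: graph_sphere_def)
  then have "sphere_inter x0 n y 0 = (if k = n then {y} else {})"
    unfolding sphere_inter_def using y by (simp add: graph_sphere_def)
  then show ?thesis by (simp add: N_eq[OF y])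
qed

lemma N_unit_right: "N m 0 k = (if k = m then 1 else 0)"
proof -
  obtain y where y: "y \<in> S k" using sphere_nonempty by blast
  then have "gdist y x0 = k" using root gdist_sym[of y x0] by (simp add: graph_sphere_def)
  then have "sphere_inter x0 0 y m = (if k = m then {x0} else {})"
    unfolding sphere_inter_def sphere_0[OF root] using root by (simp add: graph_sphere_def)
  then show ?thesis by (simp add: N_eq[OF y])
qed

text \<open>The only vertex counted is the ancestor of \<open>y\<close> lying \<open>s\<close>
  levels above it: the parent or the grandparent.\<close>

lemma N_step: "N s n (n + s) = 1"
proof -
  obtain y where y: "y \<in> S (n + s)" using sphere_nonempty by blast
  then have Y: "y \<in> pverts T" "gdist x0 y = n + s" by (auto simp: graph_sphere_def)
  consider "s = 1" | "s = 2" using s by blast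
  then show ?thesis
  proof cases
    case 1
    then show ?thesis using card_sphere_inter_1[OF root Y(1), of n] Y N_eq[OF y, of s n] by simp
  next
    case 2
    then show ?thesis using card_sphere_inter_2_far[OF root Y(1), of n] Y N_eq[OF y, of s n] by simp
  qed
qed

text \<open>Dividing distances by \<open>s\<close> numbers the double cosets by all natural numbers,
  with the generator \<open>D s\<close> at index 1.\<close>

sublocale hecke: enumerated_hecke_pair G K "\<lambda>n. D (s * n)" "\<lambda>a b k. N (s * a) (s * b) (s * k)"
proof
  show "inj (\<lambda>n. D (s * n))"
  proof (rule injI)
    fix a b assume eq: "D (s * a) = D (s * b)"
    obtain g where "g \<in> D (s * a)" using D_nonempty[of "s * a"] by auto
    moreover from this have "g \<in> D (s * b)" using eq by blast
    ultimately have "s * a = s * b" by (simp add: displacement_set_def)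
    then show "a = b" using s_pos by simp
  qed
  show "double_cosets G K = range (\<lambda>n. D (s * n))" by (rule double_cosets_D)
  show "D (s * 0) = K"
    using gdist_eq_0_iff act_closed root by (auto simp: displacement_set_def K_iff)
  show "hecke_const G K (D (s * a)) (D (s * b)) (D (s * k)) = N (s * a) (s * b) (s * k)" for a b k
    by (rule hecke_const_N) simp_all
  show "k \<le> a + b" if "N (s * a) (s * b) (s * k) \<noteq> 0" for a b k
  proof -
    have "s * k \<le> s * (a + b)" using N_bound[OF that] by (simp add: distrib_left add.commute)
    then show ?thesis using s_pos by simp
  qed
  show "N (s * 0) (s * b) (s * k) = (if k = b then 1 else 0)" for b k
    using s_pos by (simp add: N_unit_left)
  show "N (s * b) (s * 0) (s * k) = (if k = b then 1 else 0)" for b k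
    using s_pos by (simp add: N_unit_right)
  show "N (s * 1) (s * n) (s * Suc n) = 1" for n
    using N_step[of "s * n"] by (simp add: add.commute)
  show "(\<Sum>k\<le>L. N (s * a) (s * b) (s * k) * N (s * k) (s * d) (s * l)) =
    (\<Sum>k\<le>L. N (s * b) (s * d) (s * k) * N (s * a) (s * k) (s * l))"
    if "a + b \<le> L" "b + d \<le> L" for a b d l L
    using that by (rule N_assoc)
qed

lemma canonical_basis_eq:
  "canonical_basis G K = {basis_elem (D (s * n)) |n. True}"
  unfolding canonical_basis_def double_cosets_D by auto

end

section \<open>The recursions for one and for two orbits\<close>

lemma (in tree_action) hecke_one_orbit:
  assumes tr: "transitive_action G (pverts T) \<phi>"
  fixes B :: "nat \<Rightarrow> ('g set \<Rightarrow>\<^sub>0 complex)" and A :: "(complex, 'g set \<Rightarrow>\<^sub>0 complex) module"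
  defines "B \<equiv> \<lambda>n. basis_elem (D n)" and "A \<equiv> complex_hecke_algebra G K"
  assumes q: "\<And>v. v \<in> pverts T \<Longrightarrow> vertex_degree T v = q + 1"
  shows "canonical_basis G K = {B n |n. True}"
    and "\<exists>h\<in>algebra_iso poly_algebra A. h [:0, 1:] = B 1"
    and "1 \<le> n \<Longrightarrow> B 1 \<otimes>\<^bsub>A\<^esub> B n =
      (of_nat (q + (if n = 1 then 1 else 0)) \<odot>\<^bsub>A\<^esub> B (n - 1)) \<oplus>\<^bsub>A\<^esub> B (n + 1)"
proof -
  interpret tree_action_period T G \<phi> x0 1
    by unfold_locales (use transitive_Orb[OF tr] in simp_all)
  show "canonical_basis G K = {B n |n. True}"
    using canonical_basis_eq by (simp add: B_def)
  show "\<exists>h\<in>algebra_iso poly_algebra A. h [:0, 1:] = B 1"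
    using hecke.poly_eval_algebra_iso hecke.poly_eval_X
    unfolding A_def B_def by (metis mult_1)
  assume n: "1 \<le> n"
  \<comment> \<open>For \<open>n = l + 1\<close> the vertex at distance \<open>l\<close> is the root
    exactly when \<open>n = 1\<close>; then all \<open>q + 1\<close> neighbours count instead of
    \<open>q\<close> children.\<close>
  have c: "N 1 n l = (if l = n + 1 then 1 else if n = l + 1 then q + (if n = 1 then 1 else 0) else 0)" for l
  proof -
    obtain y where y: "y \<in> S l" using sphere_nonempty by blast
    then have Y: "y \<in> pverts T" "gdist x0 y = l" by (auto simp: graph_sphere_def)
    have "y = x0 \<longleftrightarrow> l = 0" using gdist_eq_0_iff[OF root Y(1)] Y by auto
    then show ?thesis
      unfolding N_eq[OF y] card_sphere_inter_1[OF root Y(1)] using Y q[OF Y(1)] by simp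
  qed
  have L: "Poly_Mapping.lookup (B k) (D l) = (if l = k then 1 else 0)" for k l
    using hecke.coeff_at_single[of k "1::complex" l] by (simp add: B_def basis_elem_def)
  have P: "Poly_Mapping.lookup (hecke.hmult (B 1) (B n)) (D l) = of_nat (N 1 n l)" for l
    using hecke.coeff_at_hmult_basis_elem[of 1 n l, where 'r = complex] by (simp add: B_def)
  have "hecke.hmult (B 1) (B n) =
      Poly_Mapping.map ((*) (of_nat (q + (if n = 1 then 1 else 0)))) (B (n - 1)) + B (n + 1)"
  proof (rule hecke.eqI)
    have B: "Poly_Mapping.keys (B k) \<subseteq> range (\<lambda>n. D (1 * n))" for k
      by (simp add: B_def basis_elem_def)
    then show "Poly_Mapping.keys (hecke.hmult (B 1) (B n)) \<subseteq> range (\<lambda>n. D (1 * n))"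
      "Poly_Mapping.keys (Poly_Mapping.map ((*) (of_nat (q + (if n = 1 then 1 else 0)))) (B (n - 1)) + B (n + 1))
        \<subseteq> range (\<lambda>n. D (1 * n))"
      by (intro hecke.carrier_simps B)+
    fix l
    show "hecke.coeff_at (hecke.hmult (B 1) (B n)) l =
      hecke.coeff_at (Poly_Mapping.map ((*) (of_nat (q + (if n = 1 then 1 else 0)))) (B (n - 1)) + B (n + 1)) l"
      using n by (simp add: lookup_add lookup_map_mult L P c del: One_nat_def)
  qed
  then show "B 1 \<otimes>\<^bsub>A\<^esub> B n =
      (of_nat (q + (if n = 1 then 1 else 0)) \<odot>\<^bsub>A\<^esub> B (n - 1)) \<oplus>\<^bsub>A\<^esub> B (n + 1)"
    by (simp add: A_def hecke_algebra_def)
qed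

lemma (in tree_action) hecke_two_orbits:
  assumes two: "card (orbits G (pverts T) \<phi>) = 2"
  fixes B :: "nat \<Rightarrow> ('g set \<Rightarrow>\<^sub>0 complex)" and A :: "(complex, 'g set \<Rightarrow>\<^sub>0 complex) module"
  defines "B \<equiv> \<lambda>n. basis_elem (D n)" and "A \<equiv> complex_hecke_algebra G K"
  assumes q0: "\<And>v. v \<in> pverts T \<Longrightarrow> even (gdist x0 v) \<Longrightarrow> vertex_degree T v = q0 + 1"
    and q1: "\<And>v. v \<in> pverts T \<Longrightarrow> odd (gdist x0 v) \<Longrightarrow> vertex_degree T v = q1 + 1"
  shows "canonical_basis G K = {B (2 * n) |n. True}"
    and "\<exists>h\<in>algebra_iso poly_algebra A. h [:0, 1:] = B 2"
    and "1 \<le> n \<Longrightarrow> B 2 \<otimes>\<^bsub>A\<^esub> B (2 * n) =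
      (of_nat ((q0 + (if n = 1 then 1 else 0)) * q1) \<odot>\<^bsub>A\<^esub> B (2 * n - 2))
      \<oplus>\<^bsub>A\<^esub> ((of_nat q1 - 1) \<odot>\<^bsub>A\<^esub> B (2 * n)) \<oplus>\<^bsub>A\<^esub> B (2 * n + 2)"
proof -
  interpret tree_action_period T G \<phi> x0 2
    by unfold_locales (use Orb_two_orbits[OF two] in simp_all)
  show "canonical_basis G K = {B (2 * n) |n. True}"
    using canonical_basis_eq by (simp add: B_def)
  show "\<exists>h\<in>algebra_iso poly_algebra A. h [:0, 1:] = B 2"
    using hecke.poly_eval_algebra_iso hecke.poly_eval_X
    unfolding A_def B_def by (metis mult.right_neutral)
  assume n: "1 \<le> n"
  \<comment> \<open>Needed so that the truncated difference \<open>q1 - 1\<close> of natural numbers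
    agrees with the complex one.\<close>
  have "1 \<le> q1"
  proof -
    obtain v where "v \<in> S 1" using sphere_nonempty by blast
    then show ?thesis using q1[of v] degree_ge_3[of v] by (simp add: graph_sphere_def)
  qed
  then have q1_minus: "of_nat (q1 - 1) = (of_nat q1 - 1 :: complex)" by (simp add: of_nat_diff)
  \<comment> \<open>The nonzero values count the grandparent, the siblings and the grandchildren of
    a vertex at distance \<open>2 * l\<close>. In the last case it is the root iff
    \<open>n = 1\<close>, and then it has \<open>q0 + 1\<close> children instead of
    \<open>q0\<close>.\<close>
  have c: "N 2 (2 * n) (2 * l) = (if l = n + 1 then 1 else if l = n then q1 - 1
      else if n = l + 1 then (q0 + (if n = 1 then 1 else 0)) * q1 else 0)" for l
  proof -
    obtain y where y: "y \<in> S (2 * l)" using sphere_nonempty by blast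
    then have Y: "y \<in> pverts T" "gdist x0 y = 2 * l" by (auto simp: graph_sphere_def)
    \<comment> \<open>The middle vertices of two-step walks from \<open>y\<close> lie at odd
      distance from the root, so \<open>q1\<close> governs their degree.\<close>
    have nb: "vertex_degree T w = q1 + 1" if "(y, w) \<in> parcs T" for w
    proof -
      have "odd (gdist x0 w)" using adjacent_gdist[OF root that] Y(2) by presburger
      then show ?thesis using q1 in_arcsD2[OF that] by blast
    qed
    have "y = x0 \<longleftrightarrow> l = 0" using gdist_eq_0_iff[OF root Y(1)] Y by auto
    then show ?thesis
      unfolding N_eq[OF y] using card_sphere_inter_2[OF root Y(1) nb, of "2 * n"] Y q0[OF Y(1)] n
      by (auto split: if_splits)
  qed
  have L: "Poly_Mapping.lookup (B (2 * k)) (D (2 * l)) = (if l = k then 1 else 0)" for k l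
    using hecke.coeff_at_single[of k "1::complex" l] by (simp add: B_def basis_elem_def)
  have P: "Poly_Mapping.lookup (hecke.hmult (B 2) (B (2 * n))) (D (2 * l)) = of_nat (N 2 (2 * n) (2 * l))" for l
    using hecke.coeff_at_hmult_basis_elem[of 1 n l, where 'r = complex] by (simp add: B_def)
  let ?rhs = "Poly_Mapping.map ((*) (of_nat ((q0 + (if n = 1 then 1 else 0)) * q1))) (B (2 * (n - 1))) +
      Poly_Mapping.map ((*) (of_nat q1 - 1)) (B (2 * n)) + B (2 * (n + 1))"
  have "hecke.hmult (B 2) (B (2 * n)) = ?rhs"
  proof (rule hecke.eqI)
    have B: "Poly_Mapping.keys (B (2 * k)) \<subseteq> range (\<lambda>n. D (2 * n))" for k
      by (simp add: B_def basis_elem_def)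
    show "Poly_Mapping.keys (hecke.hmult (B 2) (B (2 * n))) \<subseteq> range (\<lambda>n. D (2 * n))"
      using hecke.keys_hmult_range[OF B[of 1] B[of n]] by simp
    show "Poly_Mapping.keys ?rhs \<subseteq> range (\<lambda>n. D (2 * n))"
      by (intro hecke.carrier_simps B)
    fix l
    show "hecke.coeff_at (hecke.hmult (B 2) (B (2 * n))) l = hecke.coeff_at ?rhs l"
      unfolding lookup_add lookup_map_mult L P c using n q1_minus by auto
  qed
  moreover have "2 * (n - 1) = 2 * n - 2" "2 * (n + 1) = 2 * n + 2" by simp_all
  ultimately show "B 2 \<otimes>\<^bsub>A\<^esub> B (2 * n) =
      (of_nat ((q0 + (if n = 1 then 1 else 0)) * q1) \<odot>\<^bsub>A\<^esub> B (2 * n - 2))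
      \<oplus>\<^bsub>A\<^esub> ((of_nat q1 - 1) \<odot>\<^bsub>A\<^esub> B (2 * n)) \<oplus>\<^bsub>A\<^esub> B (2 * n + 2)"
    by (simp only: A_def hecke_algebra_def) simp
qed

text \<open>In the transitive case \<open>q0\<close> serves as q. Suitable \<open>q0\<close> and
  \<open>q1\<close> always exist, because degrees are constant on each parity class and at least
  3.\<close>

theorem theorem3p3:
  fixes T :: "'v pair_pre_digraph" and x0 :: 'v
    and \<Gamma> :: "('g, 'm) monoid_scheme" and \<phi> :: "'g \<Rightarrow> 'v \<Rightarrow> 'v"
    and \<Gamma>0 :: "'g set" and A :: "(complex, 'g set \<Rightarrow>\<^sub>0 complex) module"
    and B :: "nat \<Rightarrow> ('g set \<Rightarrow>\<^sub>0 complex)"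
  defines "\<Gamma>0 \<equiv> stabilizer \<Gamma> \<phi> x0"
    and "A \<equiv> complex_hecke_algebra \<Gamma> \<Gamma>0"
    and "B \<equiv> \<lambda>n. basis_elem (displacement_set \<Gamma> T \<phi> x0 n)"
  assumes "undirected_tree T" and "locally_finite T"
    and "\<forall>v\<in>pverts T. 3 \<le> vertex_degree T v"
    and "x0 \<in> pverts T"
    and "acts_by_automorphisms \<Gamma> T \<phi>"
    and "\<Gamma>0 \<noteq> carrier \<Gamma>"
    and "\<forall>n. \<forall>u\<in>graph_sphere T x0 n. \<forall>v\<in>graph_sphere T x0 n. \<exists>g\<in>\<Gamma>0. \<phi> g u = v"
  shows "semi_homogeneous T \<and> hecke_pair \<Gamma> \<Gamma>0 \<and>
    card (orbits \<Gamma> (pverts T) \<phi>) \<in> {1, 2} \<and>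
    (\<forall>q0 q1 :: nat.
      (\<forall>v\<in>pverts T. even (graph_dist T x0 v) \<longrightarrow> vertex_degree T v = q0 + 1) \<and>
      (\<forall>v\<in>pverts T. odd (graph_dist T x0 v) \<longrightarrow> vertex_degree T v = q1 + 1) \<longrightarrow>
      (transitive_action \<Gamma> (pverts T) \<phi> \<longrightarrow>
         homogeneous T \<and>
         canonical_basis \<Gamma> \<Gamma>0 = {B n |n. True} \<and>
         (\<exists>h\<in>algebra_iso poly_algebra A. h [:0, 1:] = B 1) \<and>
         (\<forall>n\<ge>1. B 1 \<otimes>\<^bsub>A\<^esub> B n =
            (of_nat (q0 + (if n = 1 then 1 else 0)) \<odot>\<^bsub>A\<^esub> B (n - 1)) \<oplus>\<^bsub>A\<^esub> B (n + 1))) \<and>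
      (card (orbits \<Gamma> (pverts T) \<phi>) = 2 \<longrightarrow>
         canonical_basis \<Gamma> \<Gamma>0 = {B (2 * n) |n. True} \<and>
         (\<exists>h\<in>algebra_iso poly_algebra A. h [:0, 1:] = B 2) \<and>
         (\<forall>n\<ge>1. B 2 \<otimes>\<^bsub>A\<^esub> B (2 * n) =
            (of_nat ((q0 + (if n = 1 then 1 else 0)) * q1) \<odot>\<^bsub>A\<^esub> B (2 * n - 2))
            \<oplus>\<^bsub>A\<^esub> ((of_nat q1 - 1) \<odot>\<^bsub>A\<^esub> B (2 * n)) \<oplus>\<^bsub>A\<^esub> B (2 * n + 2))))"
proof -
  interpret pair_bidirected_digraph T using assms(4) by (simp add: undirected_tree_def)
  interpret group_action \<Gamma> "pverts T" \<phi> using assms(8) by (simp add: acts_by_automorphisms_def)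
  have arc: "(\<phi> g u, \<phi> g v) \<in> parcs T" if "g \<in> carrier \<Gamma>" "(u, v) \<in> parcs T" for g u v
    using assms(8) that in_arcsD1 in_arcsD2 by (auto simp: acts_by_automorphisms_def)
  interpret tree_action T \<Gamma> \<phi> x0
  proof
    show "strongly_connected (with_proj T)" using assms(4) by (simp add: undirected_tree_def)
    show "length p < 3" if "cycle p" for p
      using assms(4) that by (auto simp: undirected_tree_def not_le)
    show "locally_finite T" "x0 \<in> pverts T" by fact+
    show "3 \<le> vertex_degree T v" if "v \<in> pverts T" for v using assms(6) that by blast
    show "(\<phi> g u, \<phi> g v) \<in> parcs T" if "g \<in> carrier \<Gamma>" "(u, v) \<in> parcs T" for g u v
      by (rule arc[OF that])
    show "\<exists>g\<in>carrier \<Gamma>. \<phi> g x0 \<noteq> x0"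
      using assms(9) by (auto simp: assms(1) stabilizer_def)
    show "\<exists>g\<in>stabilizer \<Gamma> \<phi> x0. \<phi> g u = v"
      if "u \<in> graph_sphere T x0 n" "v \<in> graph_sphere T x0 n" for u v n
      using assms(10) that by (auto simp: assms(1))
  qed
  \<comment> \<open>The Hecke pair property is claimed without fixing the number of orbits, so it is
    derived for either period.\<close>
  have hp: "hecke_pair \<Gamma> \<Gamma>0"
  proof (cases "card (orbits \<Gamma> (pverts T) \<phi>) = 2")
    case True
    then interpret tree_action_period T \<Gamma> \<phi> x0 2
      by unfold_locales (use Orb_two_orbits in simp_all)
    show ?thesis using hecke_pair by (simp add: assms(1))
  next
    case False
    then interpret tree_action_period T \<Gamma> \<phi> x0 1
      by unfold_locales (use Orb_one_orbit in simp_all)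
    show ?thesis using hecke_pair by (simp add: assms(1))
  qed
  show ?thesis
  proof (intro conjI allI impI)
    show "semi_homogeneous T" by (rule semi_homogeneous)
    show "hecke_pair \<Gamma> \<Gamma>0" by (rule hp)
    show "card (orbits \<Gamma> (pverts T) \<phi>) \<in> {1, 2}" by (rule card_orbits)
  next
    fix q0 q1
    assume q: "(\<forall>v\<in>pverts T. even (graph_dist T x0 v) \<longrightarrow> vertex_degree T v = q0 + 1) \<and>
      (\<forall>v\<in>pverts T. odd (graph_dist T x0 v) \<longrightarrow> vertex_degree T v = q1 + 1)"
    assume tr: "transitive_action \<Gamma> (pverts T) \<phi>"
    then show hom: "homogeneous T" by (rule transitive_homogeneous)
    \<comment> \<open>The root has even distance 0 from itself; homogeneity spreads its degree to
      all vertices.\<close>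
    have "vertex_degree T x0 = q0 + 1" using q root by simp
    then have deg: "vertex_degree T v = q0 + 1" if "v \<in> pverts T" for v
      using hom that root by (metis homogeneous_def)
    note * = hecke_one_orbit[OF tr deg]
    show "canonical_basis \<Gamma> \<Gamma>0 = {B n |n. True}" unfolding assms(1-3) by (rule *(1))
    show "\<exists>h\<in>algebra_iso poly_algebra A. h [:0, 1:] = B 1" unfolding assms(1-3) by (rule *(2))
    show "B 1 \<otimes>\<^bsub>A\<^esub> B n =
      (of_nat (q0 + (if n = 1 then 1 else 0)) \<odot>\<^bsub>A\<^esub> B (n - 1)) \<oplus>\<^bsub>A\<^esub> B (n + 1)" if "1 \<le> n" for n
      unfolding assms(1-3) by (rule *(3)) (use that in simp_all)
  next
    fix q0 q1
    assume q: "(\<forall>v\<in>pverts T. even (graph_dist T x0 v) \<longrightarrow> vertex_degree T v = q0 + 1) \<and>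
      (\<forall>v\<in>pverts T. odd (graph_dist T x0 v) \<longrightarrow> vertex_degree T v = q1 + 1)"
    assume two: "card (orbits \<Gamma> (pverts T) \<phi>) = 2"
    have q0: "\<And>v. v \<in> pverts T \<Longrightarrow> even (gdist x0 v) \<Longrightarrow> vertex_degree T v = q0 + 1"
      and q1: "\<And>v. v \<in> pverts T \<Longrightarrow> odd (gdist x0 v) \<Longrightarrow> vertex_degree T v = q1 + 1"
      using q by auto
    note * = hecke_two_orbits[OF two q0 q1]
    show "canonical_basis \<Gamma> \<Gamma>0 = {B (2 * n) |n. True}" unfolding assms(1-3) by (rule *(1))
    show "\<exists>h\<in>algebra_iso poly_algebra A. h [:0, 1:] = B 2" unfolding assms(1-3) by (rule *(2))
    show "B 2 \<otimes>\<^bsub>A\<^esub> B (2 * n) =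
      (of_nat ((q0 + (if n = 1 then 1 else 0)) * q1) \<odot>\<^bsub>A\<^esub> B (2 * n - 2))
      \<oplus>\<^bsub>A\<^esub> ((of_nat q1 - 1) \<odot>\<^bsub>A\<^esub> B (2 * n)) \<oplus>\<^bsub>A\<^esub> B (2 * n + 2)" if "1 \<le> n" for n
      unfolding assms(1-3) by (rule *(3)) (use that in simp_all)
  qed
qed

end
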